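(* Let $\Omega\subseteq\mathbb{R}^2$ be open and let $L$ be the Grushin-type operator of the context with ellipticity constants $0<\lambda\le\Lambda$. There exist structural constants $C,\eta>1$ such that if $f:\Omega\to\mathbb{R}$ is measurable and bounded and $u\in C^2(\Omega)\cap C(\overline\Omega)$ is a nonnegative solution of $Lu=x_1^2f$ in $\Omega$, then $$\sup_{B(y,r)}u\le C\Bigl(\inf_{B(y,r)}u+\operatorname{diam}(B(y,\eta r))\,\|x_1f\|_{L^2(B(y,\eta r))}\Bigr)$$ for every $B(y,\eta r)\subset\Omega$.
   Context: Points of $\mathbb{R}^2$ are $x=(x_1,x_2)$. Let $X=\partial_{x_1}$, $Y=x_1\partial_{x_2}$ and $$L=a_{11}(x)X^2+a_{22}(x)Y^2+2a_{12}(x)YX,$$ i.e. $Lu=a_{11}u_{x_1x_1}+2a_{12}x_1u_{x_1x_2}+a_{22}x_1^2u_{x_2x_2}$, with $a_{ij}:\Omega\to\mathbb{R}$ measurable and $\lambda|\xi|^2\le a_{11}\xi_1^2+a_{22}\xi_2^2+2a_{12}\xi_1\xi_2\le\Lambda|\xi|^2$ for all $\xi\in\mathbb{R}^2$, at every point of $\Omega$. $\operatorname{diam}$ is the Euclidean diameter. $B(y,r)=\{x\in\mathbb{R}^2:\tilde d(x,y)<r\}$ where $$\tilde d(x,y)=|x_1-y_1|+\sqrt{x_1^2+y_1^2+4|x_2-y_2|}-\sqrt{x_1^2+y_1^2}.$$ A structural constant is one independent of $u$, of $f$ and of the balls (i.e. of $y$ and $r$); it may depend on $\lambda,\Lambda$.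 *)

theory Defs
  imports "HOL-Analysis.Analysis"
begin

definition has_partial :: "'n \<Rightarrow> (real^'n \<Rightarrow> real) \<Rightarrow> real^'n \<Rightarrow> bool" where
  "has_partial i u x \<longleftrightarrow> (\<lambda>t::real. u (x + t *\<^sub>R axis i 1)) differentiable (at 0)"

text \<open>Meaningful only where \<open>has_partial i u x\<close> holds.\<close>

definition partial :: "'n \<Rightarrow> (real^'n \<Rightarrow> real) \<Rightarrow> real^'n \<Rightarrow> real" where
  "partial i u x = deriv (\<lambda>t::real. u (x + t *\<^sub>R axis i 1)) 0"

text \<open>\<open>Ck_on k S u\<close> is \<open>u \<in> C^k(S)\<close>; it is intended for open \<open>S\<close>, where it does not
  depend on the values of \<open>u\<close> outside \<open>S\<close>.\<close>

primrec Ck_on :: "nat \<Rightarrow> (real^'n) set \<Rightarrow> (real^'n \<Rightarrow> real) \<Rightarrow> bool" where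
  "Ck_on 0 S u \<longleftrightarrow> continuous_on S u"
| "Ck_on (Suc k) S u \<longleftrightarrow>
     continuous_on S u \<and> (\<forall>i. (\<forall>x\<in>S. has_partial i u x) \<and> Ck_on k S (partial i u))"

definition X_field :: "(real^2 \<Rightarrow> real) \<Rightarrow> real^2 \<Rightarrow> real" where
  "X_field u x = partial 1 u x"

definition Y_field :: "(real^2 \<Rightarrow> real) \<Rightarrow> real^2 \<Rightarrow> real" where
  "Y_field u x = x $ 1 * partial 2 u x"

definition grushin_op ::
  "(real^2 \<Rightarrow> real) \<Rightarrow> (real^2 \<Rightarrow> real) \<Rightarrow> (real^2 \<Rightarrow> real) \<Rightarrow> (real^2 \<Rightarrow> real) \<Rightarrow> real^2 \<Rightarrow> real" where
  "grushin_op a11 a12 a22 u x =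
     a11 x * X_field (X_field u) x + a22 x * Y_field (Y_field u) x
       + 2 * a12 x * Y_field (X_field u) x"

definition grushin_coeffs ::
  "(real^2) set \<Rightarrow> real \<Rightarrow> real \<Rightarrow> (real^2 \<Rightarrow> real) \<Rightarrow> (real^2 \<Rightarrow> real) \<Rightarrow> (real^2 \<Rightarrow> real) \<Rightarrow> bool" where
  "grushin_coeffs \<Omega> lam Lam a11 a12 a22 \<longleftrightarrow>
     a11 \<in> borel_measurable (lebesgue_on \<Omega>) \<and>
     a12 \<in> borel_measurable (lebesgue_on \<Omega>) \<and>
     a22 \<in> borel_measurable (lebesgue_on \<Omega>) \<and>
     (\<forall>x\<in>\<Omega>. \<forall>\<xi>::real^2.
        lam * (norm \<xi>)\<^sup>2 \<le> a11 x * (\<xi> $ 1)\<^sup>2 + a22 x * (\<xi> $ 2)\<^sup>2 + 2 * a12 x * \<xi> $ 1 * \<xi> $ 2 \<and>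
        a11 x * (\<xi> $ 1)\<^sup>2 + a22 x * (\<xi> $ 2)\<^sup>2 + 2 * a12 x * \<xi> $ 1 * \<xi> $ 2 \<le> Lam * (norm \<xi>)\<^sup>2)"

definition grushin_dist :: "real^2 \<Rightarrow> real^2 \<Rightarrow> real" where
  "grushin_dist x y =
     \<bar>x $ 1 - y $ 1\<bar> + sqrt ((x $ 1)\<^sup>2 + (y $ 1)\<^sup>2 + 4 * \<bar>x $ 2 - y $ 2\<bar>)
       - sqrt ((x $ 1)\<^sup>2 + (y $ 1)\<^sup>2)"

definition grushin_ball :: "real^2 \<Rightarrow> real \<Rightarrow> (real^2) set" where
  "grushin_ball y r = {x. grushin_dist x y < r}"

definition L2_norm_on :: "(real^'n) set \<Rightarrow> (real^'n \<Rightarrow> real) \<Rightarrow> real" where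
  "L2_norm_on S g = sqrt (LINT x:S|lebesgue. (g x)\<^sup>2)"

end

(* In the plane the Harnack inequality for nondivergence form operators follows from the maximum
   principle and planar topology, without covering arguments. The Aleksandrov-Bakelman-Pucci
   estimate applied to L, whose coefficient determinant is at least lam^2 x_1^2, gives every comparison
   principle with the error diam * ||x_1 f|| / (2 lam sqrt pi). If u(z) is large, the component of
   {u > u(z)/2} containing z must therefore leave a large box, and yields a path of large values. If u
   were small at a suitable point t, two opposite exponential barriers would give a path of small
   values through t separating the ends of the first path, which contradicts Fashoda's theorem.
   Further barriers carry the resulting lower bound to the inner box. All boxes are taken in the
   coordinates (x_1 - y_1) / r and (x_2 - y_2) / (r (r + |y_1|)), in which grushin balls are
   uniformly comparable to boxes; barriers growing in x_2 are only used at distance at least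
   (r + |y_1|) / 10 from the degenerate axis x_1 = 0. *)

theory Submission
  imports Defs
begin

section \<open>Twice continuously differentiable functions of two variables\<close>

text \<open>The obstacle is the axis \<open>x_1 = 0\<close>, where the coefficient of the second
  \<open>x_2\<close> derivative vanishes. A barrier can be driven in the \<open>x_1\<close>
  direction anywhere, because \<open>a11\<close> stays at least \<open>lam\<close>. This dictates
  the order of the moves. A path of large values leaving through the top or bottom may run along the
  axis, so it is crossed by barriers driven in \<open>x_1\<close>; the bound obtained on a
  horizontal segment is moved vertically inside a strip chosen off the axis, and then horizontally
  back to the inner box. A path leaving sideways must cross such a strip and is met there directly.
  The degeneracy does not spoil the Aleksandrov-Bakelman-Pucci estimate because the right-hand side
  carries the weight \<open>x_1^2\<close>: its square divided by a determinant of order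
  \<open>x_1^2\<close> leaves \<open>(x_1 f)^2\<close>. At most three comparisons are chained. Each
  costs one \<open>err\<close> and one factor that is a difference of two exponentials depending
  only on \<open>Lam / lam\<close>, so the constant is explicit and nothing is iterated.\<close>

lemma mvt_from_0:
  fixes F F' :: "real \<Rightarrow> real"
  assumes "\<And>t. \<bar>t\<bar> \<le> \<bar>a\<bar> \<Longrightarrow> (F has_real_derivative F' t) (at t)"
  obtains t where "\<bar>t\<bar> \<le> \<bar>a\<bar>" "F a - F 0 = a * F' t"
proof -
  consider "a = 0" | "a > 0" | "a < 0" by linarith
  then show thesis
  proof cases
    case 1
    then show ?thesis using that[of 0] by simp
  next
    case 2
    then obtain t where "0 < t" "t < a" "F a - F 0 = (a - 0) * F' t"
      using MVT2[of 0 a F F'] assms by fastforce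
    then show ?thesis using that[of t] by simp
  next
    case 3
    then obtain t where "a < t" "t < 0" "F 0 - F a = (0 - a) * F' t"
      using MVT2[of a 0 F F'] assms by fastforce
    then show ?thesis using that[of t] by (simp add: algebra_simps)
  qed
qed

lemma has_partial_DERIV:
  assumes "has_partial i u (x + s *\<^sub>R axis i 1)"
  shows "((\<lambda>t. u (x + t *\<^sub>R axis i 1)) has_real_derivative partial i u (x + s *\<^sub>R axis i 1)) (at s)"
proof -
  have "((\<lambda>t. u ((x + s *\<^sub>R axis i 1) + t *\<^sub>R axis i 1))
          has_real_derivative partial i u (x + s *\<^sub>R axis i 1)) (at 0)"
    using assms unfolding has_partial_def partial_def
    by (simp add: DERIV_deriv_iff_real_differentiable)
  then have "((\<lambda>t. u (x + (t + s) *\<^sub>R axis i 1))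
          has_real_derivative partial i u (x + s *\<^sub>R axis i 1)) (at 0)"
    by (simp add: algebra_simps)
  then show ?thesis
    using DERIV_shift[of "\<lambda>t. u (x + t *\<^sub>R axis i 1)" _ 0 s] by simp
qed

lemma vec2_axis_decomp: "(y :: real^2) = x + (y $ 1 - x $ 1) *\<^sub>R axis 1 1 + (y $ 2 - x $ 2) *\<^sub>R axis 2 1"
  by (simp add: vec_eq_iff forall_2 axis_def)

lemma norm_axis_comb_le: "norm (a *\<^sub>R axis 1 1 + b *\<^sub>R axis 2 1 :: real^2) \<le> \<bar>a\<bar> + \<bar>b\<bar>"
  by (rule order_trans[OF norm_triangle_ineq]) (simp add: norm_axis_1)

text \<open>\<open>Ck_on\<close> only supplies derivatives along coordinate lines, whereas
  derivatives along arbitrary lines and the area formula need total differentiability. Going from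
  \<open>x\<close> to \<open>y\<close> along two axis-parallel segments, with the mean value theorem
  on each, provides it.\<close>

lemma has_derivative_continuous_partials:
  fixes u :: "real^2 \<Rightarrow> real"
  assumes S: "open S" and part: "\<And>i x. x \<in> S \<Longrightarrow> has_partial i u x"
    and cont: "\<And>i. continuous_on S (partial i u)" and x: "x \<in> S"
  shows "(u has_derivative (\<lambda>d. partial 1 u x * d $ 1 + partial 2 u x * d $ 2)) (at x)"
  unfolding has_derivative_at_alt
proof (intro conjI allI impI)
  show "bounded_linear (\<lambda>d::real^2. partial 1 u x * d $ 1 + partial 2 u x * d $ 2)"
    by (intro bounded_linear_add bounded_linear_const_mult bounded_linear_vec_nth)
  fix e :: real assume e: "e > 0"
  have near: "\<exists>d>0. \<forall>z. dist z x < d \<longrightarrow> \<bar>partial i u z - partial i u x\<bar> < e / 2" for i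
  proof -
    have "isCont (partial i u) x" using cont S x by (simp add: continuous_on_eq_continuous_at)
    then show ?thesis using e unfolding continuous_at_eps_delta
      by (metis dist_real_def half_gt_zero)
  qed
  obtain d0 where d0: "d0 > 0" "ball x d0 \<subseteq> S" using S x openE by blast
  obtain d1 where d1: "d1 > 0" "\<And>z. dist z x < d1 \<Longrightarrow> \<bar>partial 1 u z - partial 1 u x\<bar> < e / 2"
    using near by blast
  obtain d2 where d2: "d2 > 0" "\<And>z. dist z x < d2 \<Longrightarrow> \<bar>partial 2 u z - partial 2 u x\<bar> < e / 2"
    using near by blast
  \<comment> \<open>Halved because the intermediate points are controlled by the sum of two
    coordinate increments, each at most \<open>norm (y - x)\<close>.\<close>
  define d where "d = min d0 (min d1 d2) / 2"
  show "\<exists>d>0. \<forall>y. norm (y - x) < d \<longrightarrow>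
      norm (u y - u x - (partial 1 u x * (y - x) $ 1 + partial 2 u x * (y - x) $ 2)) \<le> e * norm (y - x)"
  proof (intro exI[of _ d] conjI allI impI)
    show "d > 0" using d0 d1 d2 by (simp add: d_def)
    fix y :: "real^2" assume y: "norm (y - x) < d"
    define a b where "a = (y - x) $ 1" and "b = (y - x) $ 2"
    have ab: "\<bar>a\<bar> \<le> norm (y - x)" "\<bar>b\<bar> \<le> norm (y - x)"
      unfolding a_def b_def by (rule component_le_norm_cart)+
    have yx: "y = x + a *\<^sub>R axis 1 1 + b *\<^sub>R axis 2 1"
      unfolding a_def b_def using vec2_axis_decomp[of y x] by simp
    have close: "dist (x + s *\<^sub>R axis 1 1 + t *\<^sub>R axis 2 1) x < min d0 (min d1 d2)"
      if "\<bar>s\<bar> \<le> \<bar>a\<bar>" "\<bar>t\<bar> \<le> \<bar>b\<bar>" for s t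
    proof -
      have "dist (x + s *\<^sub>R axis 1 1 + t *\<^sub>R axis 2 1) x \<le> \<bar>s\<bar> + \<bar>t\<bar>"
        using norm_axis_comb_le[of s t] by (simp add: dist_norm add.assoc)
      also have "\<dots> < min d0 (min d1 d2)" using that ab y d_def by linarith
      finally show ?thesis .
    qed
    have inS: "x + s *\<^sub>R axis 1 1 + t *\<^sub>R axis 2 1 \<in> S"
      if "\<bar>s\<bar> \<le> \<bar>a\<bar>" "\<bar>t\<bar> \<le> \<bar>b\<bar>" for s t
      using close[OF that] d0(2) by (auto simp: dist_commute)
    obtain s where s: "\<bar>s\<bar> \<le> \<bar>a\<bar>"
      "u (x + a *\<^sub>R axis 1 1) - u x = a * partial 1 u (x + s *\<^sub>R axis 1 1)"
    proof (rule mvt_from_0[of a "\<lambda>t. u (x + t *\<^sub>R axis 1 1)" "\<lambda>t. partial 1 u (x + t *\<^sub>R axis 1 1)"])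
      fix t assume "\<bar>t\<bar> \<le> \<bar>a\<bar>"
      then show "((\<lambda>t. u (x + t *\<^sub>R axis 1 1)) has_real_derivative partial 1 u (x + t *\<^sub>R axis 1 1)) (at t)"
        using inS[of t 0] by (intro has_partial_DERIV part) simp
    qed (use that in simp)
    obtain t where t: "\<bar>t\<bar> \<le> \<bar>b\<bar>"
      "u (x + a *\<^sub>R axis 1 1 + b *\<^sub>R axis 2 1) - u (x + a *\<^sub>R axis 1 1)
         = b * partial 2 u (x + a *\<^sub>R axis 1 1 + t *\<^sub>R axis 2 1)"
    proof (rule mvt_from_0[of b "\<lambda>t. u (x + a *\<^sub>R axis 1 1 + t *\<^sub>R axis 2 1)"
          "\<lambda>t. partial 2 u (x + a *\<^sub>R axis 1 1 + t *\<^sub>R axis 2 1)"])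
      fix t assume "\<bar>t\<bar> \<le> \<bar>b\<bar>"
      then show "((\<lambda>t. u (x + a *\<^sub>R axis 1 1 + t *\<^sub>R axis 2 1)) has_real_derivative
          partial 2 u (x + a *\<^sub>R axis 1 1 + t *\<^sub>R axis 2 1)) (at t)"
        using inS[of a t] by (intro has_partial_DERIV part) simp
    qed (use that in simp)
    have "u y - u x - (partial 1 u x * a + partial 2 u x * b)
      = a * (partial 1 u (x + s *\<^sub>R axis 1 1) - partial 1 u x)
        + b * (partial 2 u (x + a *\<^sub>R axis 1 1 + t *\<^sub>R axis 2 1) - partial 2 u x)"
      using s(2) t(2) yx by (simp add: algebra_simps)
    also have "\<bar>\<dots>\<bar> \<le> \<bar>a\<bar> * (e / 2) + \<bar>b\<bar> * (e / 2)"
    proof -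
      have "\<bar>partial 1 u (x + s *\<^sub>R axis 1 1) - partial 1 u x\<bar> \<le> e / 2"
        using close[of s 0] s(1) by (intro less_imp_le d1) auto
      moreover have "\<bar>partial 2 u (x + a *\<^sub>R axis 1 1 + t *\<^sub>R axis 2 1) - partial 2 u x\<bar> \<le> e / 2"
        using close[of a t] t(1) by (intro less_imp_le d2) auto
      ultimately show ?thesis
        by (intro order_trans[OF abs_triangle_ineq] add_mono) (auto simp only: abs_mult intro!: mult_left_mono abs_ge_zero)
    qed
    also have "\<dots> \<le> e * norm (y - x)"
      using mult_left_mono[OF add_mono[OF ab], of "e / 2"] e by (simp add: distrib_left mult.commute)
    finally show "norm (u y - u x - (partial 1 u x * (y - x) $ 1 + partial 2 u x * (y - x) $ 2))
        \<le> e * norm (y - x)"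
      by (simp add: a_def b_def)
  qed
qed

text \<open>The second difference over a square is unchanged when \<open>i\<close> and
  \<open>j\<close> are swapped. Evaluating it in both orders therefore compares the two mixed
  partial derivatives.\<close>

lemma second_difference_partials:
  fixes u :: "real^2 \<Rightarrow> real"
  assumes part: "\<And>s t. \<bar>s\<bar> \<le> \<bar>c\<bar> \<Longrightarrow> \<bar>t\<bar> \<le> \<bar>c\<bar> \<Longrightarrow>
      has_partial i u (x + s *\<^sub>R axis i 1 + t *\<^sub>R axis j 1)"
    and part2: "\<And>s t. \<bar>s\<bar> \<le> \<bar>c\<bar> \<Longrightarrow> \<bar>t\<bar> \<le> \<bar>c\<bar> \<Longrightarrow>
      has_partial j (partial i u) (x + s *\<^sub>R axis i 1 + t *\<^sub>R axis j 1)"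
  obtains s t where "\<bar>s\<bar> \<le> \<bar>c\<bar>" "\<bar>t\<bar> \<le> \<bar>c\<bar>"
    "u (x + c *\<^sub>R axis i 1 + c *\<^sub>R axis j 1) - u (x + c *\<^sub>R axis i 1) - u (x + c *\<^sub>R axis j 1) + u x
      = c\<^sup>2 * partial j (partial i u) (x + s *\<^sub>R axis i 1 + t *\<^sub>R axis j 1)"
proof -
  let ?F = "\<lambda>s. u (x + c *\<^sub>R axis j 1 + s *\<^sub>R axis i 1) - u (x + s *\<^sub>R axis i 1)"
  let ?F' = "\<lambda>s. partial i u (x + c *\<^sub>R axis j 1 + s *\<^sub>R axis i 1) - partial i u (x + s *\<^sub>R axis i 1)"
  obtain s where s: "\<bar>s\<bar> \<le> \<bar>c\<bar>" "?F c - ?F 0 = c * ?F' s"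
  proof (rule mvt_from_0[of c ?F ?F'])
    fix t assume t: "\<bar>t\<bar> \<le> \<bar>c\<bar>"
    have "((\<lambda>s. u (x + c *\<^sub>R axis j 1 + s *\<^sub>R axis i 1)) has_real_derivative
        partial i u (x + c *\<^sub>R axis j 1 + t *\<^sub>R axis i 1)) (at t)"
      using part[of t c] t by (intro has_partial_DERIV) (simp add: ac_simps)
    moreover have "((\<lambda>s. u (x + s *\<^sub>R axis i 1)) has_real_derivative
        partial i u (x + t *\<^sub>R axis i 1)) (at t)"
      using part[of t 0] t by (intro has_partial_DERIV) simp
    ultimately show "(?F has_real_derivative ?F' t) (at t)" by (rule DERIV_diff)
  qed (use that in simp)
  let ?G = "\<lambda>t. partial i u (x + s *\<^sub>R axis i 1 + t *\<^sub>R axis j 1)"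
  let ?G' = "\<lambda>t. partial j (partial i u) (x + s *\<^sub>R axis i 1 + t *\<^sub>R axis j 1)"
  obtain t where t: "\<bar>t\<bar> \<le> \<bar>c\<bar>" "?G c - ?G 0 = c * ?G' t"
  proof (rule mvt_from_0[of c ?G ?G'])
    fix t assume t: "\<bar>t\<bar> \<le> \<bar>c\<bar>"
    then show "(?G has_real_derivative ?G' t) (at t)"
      using part2[of s t] s by (intro has_partial_DERIV) auto
  qed (use that in simp)
  have "?F c - ?F 0 = c\<^sup>2 * ?G' t"
    using s(2) t(2) by (simp add: power2_eq_square ac_simps)
  then show thesis using that[OF s(1) t(1)] by (simp add: algebra_simps)
qed

lemma mixed_partials_eq:
  fixes u :: "real^2 \<Rightarrow> real"
  assumes S: "open S" and part: "\<And>i x. x \<in> S \<Longrightarrow> has_partial i u x"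
    and part2: "\<And>i j x. x \<in> S \<Longrightarrow> has_partial j (partial i u) x"
    and cont: "\<And>i j. continuous_on S (partial j (partial i u))" and x: "x \<in> S"
  shows "partial 1 (partial 2 u) x = partial 2 (partial 1 u) x"
proof (rule ccontr)
  let ?h = "\<lambda>i j. partial j (partial i u)"
  assume ne: "\<not> ?thesis"
  define e where "e = \<bar>?h 1 2 x - ?h 2 1 x\<bar> / 2"
  have e: "e > 0" using ne by (simp add: e_def)
  have near: "\<exists>d>0. \<forall>z. dist z x < d \<longrightarrow> \<bar>?h i j z - ?h i j x\<bar> < e" for i j
  proof -
    have "isCont (?h i j) x" using cont S x by (simp add: continuous_on_eq_continuous_at)
    then show ?thesis using e unfolding continuous_at_eps_delta by (metis dist_real_def)
  qed
  obtain d0 where d0: "d0 > 0" "ball x d0 \<subseteq> S" using S x openE by blast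
  obtain d1 where d1: "d1 > 0" "\<And>z. dist z x < d1 \<Longrightarrow> \<bar>?h 1 2 z - ?h 1 2 x\<bar> < e"
    using near by blast
  obtain d2 where d2: "d2 > 0" "\<And>z. dist z x < d2 \<Longrightarrow> \<bar>?h 2 1 z - ?h 2 1 x\<bar> < e"
    using near by blast
  define c where "c = min d0 (min d1 d2) / 3"
  have c: "c > 0" using d0 d1 d2 by (simp add: c_def)
  have close: "dist (x + s *\<^sub>R axis 1 1 + t *\<^sub>R axis 2 1) x < min d0 (min d1 d2)"
    if "\<bar>s\<bar> \<le> \<bar>c\<bar>" "\<bar>t\<bar> \<le> \<bar>c\<bar>" for s t
  proof -
    have "dist (x + s *\<^sub>R axis 1 1 + t *\<^sub>R axis 2 1) x \<le> \<bar>s\<bar> + \<bar>t\<bar>"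
      using norm_axis_comb_le[of s t] by (simp add: dist_norm add.assoc)
    also have "\<dots> < min d0 (min d1 d2)" using that c c_def by linarith
    finally show ?thesis .
  qed
  have inS: "x + s *\<^sub>R axis 1 1 + t *\<^sub>R axis 2 1 \<in> S" if "\<bar>s\<bar> \<le> \<bar>c\<bar>" "\<bar>t\<bar> \<le> \<bar>c\<bar>" for s t
    using close[OF that] d0(2) by (auto simp: dist_commute)
  have inS': "x + t *\<^sub>R axis 2 1 + s *\<^sub>R axis 1 1 \<in> S" if "\<bar>t\<bar> \<le> \<bar>c\<bar>" "\<bar>s\<bar> \<le> \<bar>c\<bar>" for s t
    using inS[OF that(2,1)] by (simp add: ac_simps)
  let ?D = "u (x + c *\<^sub>R axis 1 1 + c *\<^sub>R axis 2 1) - u (x + c *\<^sub>R axis 1 1) - u (x + c *\<^sub>R axis 2 1) + u x"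
  obtain s t where st: "\<bar>s\<bar> \<le> \<bar>c\<bar>" "\<bar>t\<bar> \<le> \<bar>c\<bar>"
    "?D = c\<^sup>2 * ?h 1 2 (x + s *\<^sub>R axis 1 1 + t *\<^sub>R axis 2 1)"
    by (rule second_difference_partials[of c 1 u x 2, OF part[OF inS] part2[OF inS]])
  obtain s' t' where st': "\<bar>s'\<bar> \<le> \<bar>c\<bar>" "\<bar>t'\<bar> \<le> \<bar>c\<bar>"
    "u (x + c *\<^sub>R axis 2 1 + c *\<^sub>R axis 1 1) - u (x + c *\<^sub>R axis 2 1) - u (x + c *\<^sub>R axis 1 1) + u x
       = c\<^sup>2 * ?h 2 1 (x + s' *\<^sub>R axis 2 1 + t' *\<^sub>R axis 1 1)"
    by (rule second_difference_partials[of c 2 u x 1, OF part[OF inS'] part2[OF inS']])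
  have "c\<^sup>2 * ?h 2 1 (x + s' *\<^sub>R axis 2 1 + t' *\<^sub>R axis 1 1) = ?D"
    using st'(3) by (simp add: ac_simps)
  then have "?h 1 2 (x + s *\<^sub>R axis 1 1 + t *\<^sub>R axis 2 1) = ?h 2 1 (x + t' *\<^sub>R axis 1 1 + s' *\<^sub>R axis 2 1)"
    using st(3) c by (simp add: ac_simps)
  moreover have "\<bar>?h 1 2 (x + s *\<^sub>R axis 1 1 + t *\<^sub>R axis 2 1) - ?h 1 2 x\<bar> < e"
    using close[OF st(1,2)] by (intro d1) simp
  moreover have "\<bar>?h 2 1 (x + t' *\<^sub>R axis 1 1 + s' *\<^sub>R axis 2 1) - ?h 2 1 x\<bar> < e"
    using close[OF st'(2,1)] by (intro d2) simp
  ultimately have "\<bar>?h 1 2 x - ?h 2 1 x\<bar> < 2 * e" by argo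
  then show False by (simp add: e_def)
qed

text \<open>A single \<open>h12\<close> serves both gradient components, so symmetry is built in.
  The derivatives are explicit parameters so that solutions and explicit barriers can be subtracted
  entry by entry.\<close>

definition has_hessian_on ::
  "(real^2) set \<Rightarrow> (real^2 \<Rightarrow> real) \<Rightarrow> (real^2 \<Rightarrow> real) \<Rightarrow> (real^2 \<Rightarrow> real) \<Rightarrow>
     (real^2 \<Rightarrow> real) \<Rightarrow> (real^2 \<Rightarrow> real) \<Rightarrow> (real^2 \<Rightarrow> real) \<Rightarrow> bool" where
  "has_hessian_on S v g1 g2 h11 h12 h22 \<longleftrightarrow>
     (\<forall>x\<in>S. (v has_derivative (\<lambda>d. g1 x * d $ 1 + g2 x * d $ 2)) (at x) \<and>
        (g1 has_derivative (\<lambda>d. h11 x * d $ 1 + h12 x * d $ 2)) (at x) \<and>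
        (g2 has_derivative (\<lambda>d. h12 x * d $ 1 + h22 x * d $ 2)) (at x)) \<and>
     continuous_on S h11 \<and> continuous_on S h12 \<and> continuous_on S h22"

lemma has_hessian_on_subset:
  "has_hessian_on S v g1 g2 h11 h12 h22 \<Longrightarrow> T \<subseteq> S \<Longrightarrow> has_hessian_on T v g1 g2 h11 h12 h22"
  unfolding has_hessian_on_def by (blast intro: continuous_on_subset)

lemma has_hessian_on_continuous:
  assumes "has_hessian_on S v g1 g2 h11 h12 h22"
  shows "continuous_on S v"
proof (rule continuous_at_imp_continuous_on, rule ballI)
  fix x assume "x \<in> S"
  then have "(v has_derivative (\<lambda>d. g1 x * d $ 1 + g2 x * d $ 2)) (at x)"
    using assms unfolding has_hessian_on_def by blast
  then show "isCont v x" by (rule has_derivative_continuous)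
qed

lemma Ck_on_2_has_hessian_on:
  fixes u :: "real^2 \<Rightarrow> real"
  assumes S: "open S" and u: "Ck_on 2 S u"
  shows "has_hessian_on S u (partial 1 u) (partial 2 u) (partial 1 (partial 1 u))
    (partial 2 (partial 1 u)) (partial 2 (partial 2 u))"
proof -
  have part: "x \<in> S \<Longrightarrow> has_partial i u x" and part2: "x \<in> S \<Longrightarrow> has_partial j (partial i u) x"
    and cont: "continuous_on S (partial i u)" and cont2: "continuous_on S (partial j (partial i u))" for i j x
    using u by (auto simp: numeral_2_eq_2)
  have sym: "partial 1 (partial 2 u) x = partial 2 (partial 1 u) x" if "x \<in> S" for x
    using S part part2 cont2 that by (rule mixed_partials_eq)
  show ?thesis unfolding has_hessian_on_def
  proof (intro conjI ballI cont2)
    fix x assume x: "x \<in> S"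
    show "(u has_derivative (\<lambda>d. partial 1 u x * d $ 1 + partial 2 u x * d $ 2)) (at x)"
      using S part cont x by (rule has_derivative_continuous_partials)
    show "(partial 1 u has_derivative
        (\<lambda>d. partial 1 (partial 1 u) x * d $ 1 + partial 2 (partial 1 u) x * d $ 2)) (at x)"
      using S part2 cont2 x by (rule has_derivative_continuous_partials)
    have "(partial 2 u has_derivative
        (\<lambda>d. partial 1 (partial 2 u) x * d $ 1 + partial 2 (partial 2 u) x * d $ 2)) (at x)"
      using S part2 cont2 x by (rule has_derivative_continuous_partials)
    then show "(partial 2 u has_derivative
        (\<lambda>d. partial 2 (partial 1 u) x * d $ 1 + partial 2 (partial 2 u) x * d $ 2)) (at x)"
      by (simp only: sym[OF x])
  qed
qed

lemma partial_eqI: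
  assumes "((\<lambda>t. u (x + t *\<^sub>R axis i 1)) has_real_derivative D) (at 0)"
  shows "partial i u x = D"
  unfolding partial_def using assms by (rule DERIV_imp_deriv)

text \<open>The factor \<open>x_1\<close> is constant along the second axis, so applying
  \<open>Y\<close> to \<open>Y u\<close> or \<open>X u\<close> creates no first-order term. The
  maximum principle can then work with the sign of the Hessian alone.\<close>

lemma grushin_op_Ck_on:
  assumes "open S" "Ck_on 2 S u" "x \<in> S"
  shows "grushin_op a11 a12 a22 u x = a11 x * partial 1 (partial 1 u) x
    + 2 * a12 x * x $ 1 * partial 2 (partial 1 u) x + a22 x * (x $ 1)\<^sup>2 * partial 2 (partial 2 u) x"
proof -
  have X: "X_field u = partial 1 u" by (simp add: X_field_def fun_eq_iff)
  have "has_partial 2 (partial 2 u) x" using assms by (auto simp: numeral_2_eq_2)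
  then have "((\<lambda>t. partial 2 u (x + t *\<^sub>R axis 2 1)) has_real_derivative partial 2 (partial 2 u) x) (at 0)"
    using has_partial_DERIV[of 2 "partial 2 u" x 0] by simp
  then have "((\<lambda>t. x $ 1 * partial 2 u (x + t *\<^sub>R axis 2 1)) has_real_derivative
      x $ 1 * partial 2 (partial 2 u) x) (at 0)" by (rule DERIV_cmult)
  then have "partial 2 (Y_field u) x = x $ 1 * partial 2 (partial 2 u) x"
    by (intro partial_eqI) (simp add: Y_field_def[abs_def] axis_def)
  then show ?thesis
    unfolding grushin_op_def Y_field_def[of "Y_field u"] Y_field_def[of "X_field u"] X_field_def[of "X_field u"] X
      X_field_def[of "partial 1 u"] Y_field_def[of "partial 1 u"]
    by (simp add: power2_eq_square algebra_simps)
qed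

section \<open>The Aleksandrov--Bakelman--Pucci estimate\<close>

lemma second_derivative_at_max:
  fixes F F' :: "real \<Rightarrow> real"
  assumes d: "d > 0" and F: "\<And>t. \<bar>t\<bar> < d \<Longrightarrow> (F has_real_derivative F' t) (at t)"
    and F': "(F' has_real_derivative l) (at 0)"
    and max: "\<And>t. \<bar>t\<bar> < d \<Longrightarrow> F t \<le> F 0"
  shows "F' 0 = 0" "l \<le> 0"
proof -
  show 0: "F' 0 = 0"
    using DERIV_local_max[OF F[of 0] d] max d by auto
  show "l \<le> 0"
  proof (rule ccontr)
    assume "\<not> l \<le> 0"
    then obtain e where e: "e > 0" "\<And>h. 0 < h \<Longrightarrow> h < e \<Longrightarrow> F' 0 < F' (0 + h)"
      using DERIV_pos_inc_right[OF F'] by (metis not_le)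
    define h where "h = min d e / 2"
    have h: "0 < h" "h < d" "h < e" using d e(1) by (auto simp: h_def)
    obtain t where t: "0 < t" "t < h" "F h - F 0 = (h - 0) * F' t"
      using MVT2[of 0 h F F'] F h by fastforce
    have "F' t > 0" using e(2)[of t] t h 0 by simp
    then have "F h > F 0" using t(3) h by (simp add: algebra_simps)
    then show False using max[of h] h by simp
  qed
qed

lemma nonpos_quadratic_form_2:
  fixes a b c :: real
  assumes q: "\<And>s t. a * s\<^sup>2 + 2 * b * s * t + c * t\<^sup>2 \<le> 0"
  shows "a \<le> 0" "c \<le> 0" "b\<^sup>2 \<le> a * c"
proof -
  show a: "a \<le> 0" using q[of 1 0] by simp
  show c: "c \<le> 0" using q[of 0 1] by simp
  show "b\<^sup>2 \<le> a * c"
  proof (cases "a = 0")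
    case True
    have "b = 0"
    proof (rule ccontr)
      assume "b \<noteq> 0"
      \<comment> \<open>A vector on which the form takes the value 1.\<close>
      then show False using q[of "(1 - c) / (2 * b)" 1] True by (simp add: field_simps)
    qed
    then show ?thesis using True by simp
  next
    case False
    \<comment> \<open>The vector \<open>(b, - a)\<close> isolates \<open>a\<close> times the
      determinant.\<close>
    have "a * (a * c - b\<^sup>2) \<le> 0"
      using q[of b "- a"] by (simp add: power2_eq_square algebra_simps)
    then show ?thesis using False a by (simp add: mult_le_0_iff)
  qed
qed

lemma has_derivative_along_line:
  fixes v :: "real^2 \<Rightarrow> real"
  assumes "(v has_derivative (\<lambda>d. a * d $ 1 + b * d $ 2)) (at (x + t *\<^sub>R \<xi>))"
  shows "((\<lambda>t. v (x + t *\<^sub>R \<xi>)) has_real_derivative (a * \<xi> $ 1 + b * \<xi> $ 2)) (at t)"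
proof -
  have "((\<lambda>t. x + t *\<^sub>R \<xi>) has_derivative (\<lambda>h. h *\<^sub>R \<xi>)) (at t)"
    by (auto intro!: derivative_eq_intros)
  from has_derivative_compose[OF this assms]
  show ?thesis unfolding has_field_derivative_def
    by (rule has_derivative_eq_rhs) (auto simp: algebra_simps)
qed

lemma axis_2_nth:
  "(axis 1 a :: real^2) $ 1 = a" "(axis 1 a :: real^2) $ 2 = 0"
  "(axis 2 a :: real^2) $ 1 = 0" "(axis 2 a :: real^2) $ 2 = a"
  by (simp_all add: axis_def)

text \<open>Subtracting an affine function leaves second derivatives alone, so the one-variable test
  on every line through \<open>x\<close> controls the whole quadratic form of the Hessian.\<close>

lemma hessian_at_interior_max:
  fixes v :: "real^2 \<Rightarrow> real"
  assumes D: "open D" and hess: "has_hessian_on D v g1 g2 h11 h12 h22" and x: "x \<in> D"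
    and max: "\<And>y. y \<in> D \<Longrightarrow> v y - inner p (y - z) \<le> v x - inner p (x - z)"
  shows "g1 x = p $ 1" "g2 x = p $ 2" "h11 x \<le> 0" "h22 x \<le> 0" "(h12 x)\<^sup>2 \<le> h11 x * h22 x"
proof -
  obtain e where e: "e > 0" "ball x e \<subseteq> D" using D x openE by blast
  have line: "g1 x * \<xi> $ 1 + g2 x * \<xi> $ 2 - inner p \<xi> = 0 \<and>
    h11 x * (\<xi> $ 1)\<^sup>2 + 2 * h12 x * \<xi> $ 1 * \<xi> $ 2 + h22 x * (\<xi> $ 2)\<^sup>2 \<le> 0" for \<xi> :: "real^2"
  proof -
    define d where "d = e / (norm \<xi> + 1)"
    have d: "d > 0" using e(1) by (simp add: d_def add_nonneg_pos)
    have inD: "x + t *\<^sub>R \<xi> \<in> D" if "\<bar>t\<bar> < d" for t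
    proof -
      have "\<bar>t\<bar> * norm \<xi> \<le> \<bar>t\<bar> * (norm \<xi> + 1)" by (intro mult_left_mono) auto
      also have "\<dots> < e" using that unfolding d_def by (subst (asm) pos_less_divide_eq) (auto intro: add_nonneg_pos)
      finally show ?thesis using e(2) by (auto simp: dist_norm)
    qed
    let ?F = "\<lambda>t. v (x + t *\<^sub>R \<xi>) - (t * inner p \<xi> + inner p (x - z))"
    let ?F' = "\<lambda>t. g1 (x + t *\<^sub>R \<xi>) * \<xi> $ 1 + g2 (x + t *\<^sub>R \<xi>) * \<xi> $ 2 - inner p \<xi>"
    let ?l = "(h11 x * \<xi> $ 1 + h12 x * \<xi> $ 2) * \<xi> $ 1 + (h12 x * \<xi> $ 1 + h22 x * \<xi> $ 2) * \<xi> $ 2"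
    have F: "(?F has_real_derivative ?F' t) (at t)" if "\<bar>t\<bar> < d" for t
    proof -
      have "((\<lambda>t. v (x + t *\<^sub>R \<xi>)) has_real_derivative
          g1 (x + t *\<^sub>R \<xi>) * \<xi> $ 1 + g2 (x + t *\<^sub>R \<xi>) * \<xi> $ 2) (at t)"
        using hess inD[OF that] unfolding has_hessian_on_def by (intro has_derivative_along_line) blast
      then show ?thesis by (auto intro!: derivative_eq_intros)
    qed
    have "((\<lambda>t. g1 (x + t *\<^sub>R \<xi>)) has_real_derivative h11 x * \<xi> $ 1 + h12 x * \<xi> $ 2) (at 0)"
      "((\<lambda>t. g2 (x + t *\<^sub>R \<xi>)) has_real_derivative h12 x * \<xi> $ 1 + h22 x * \<xi> $ 2) (at 0)"
      using hess x unfolding has_hessian_on_def by (intro has_derivative_along_line; simp)+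
    then have F': "(?F' has_real_derivative ?l) (at 0)"
      by (auto intro!: derivative_eq_intros)
    have mx: "?F t \<le> ?F 0" if "\<bar>t\<bar> < d" for t
      using max[OF inD[OF that]] by (simp add: inner_simps algebra_simps)
    have "?F' 0 = 0" "?l \<le> 0" by (rule second_derivative_at_max[OF d F F' mx]; assumption)+
    then show ?thesis by (simp add: power2_eq_square algebra_simps)
  qed
  show "g1 x = p $ 1" "g2 x = p $ 2"
    using line[of "axis 1 1"] line[of "axis 2 1"] by (simp_all add: inner_axis axis_2_nth)
  have "h11 x * s\<^sup>2 + 2 * h12 x * s * t + h22 x * t\<^sup>2 \<le> 0" for s t
    using line[of "vector [s, t]"] by (simp add: vector_2)
  from nonpos_quadratic_form_2[OF this]
  show "h11 x \<le> 0" "h22 x \<le> 0" "(h12 x)\<^sup>2 \<le> h11 x * h22 x" by auto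
qed

lemma has_derivative_vector_2:
  fixes g1 g2 :: "real^2 \<Rightarrow> real"
  assumes "(g1 has_derivative g1') (at x within S)" "(g2 has_derivative g2') (at x within S)"
  shows "((\<lambda>x. vector [g1 x, g2 x] :: real^2) has_derivative (\<lambda>d. vector [g1' d, g2' d])) (at x within S)"
proof (subst has_derivative_componentwise_within, rule ballI)
  fix i :: "real^2" assume "i \<in> Basis"
  then have "i = axis 1 1 \<or> i = axis 2 1"
    by (auto simp: Basis_vec_def) (metis exhaust_2)
  then show "((\<lambda>x. (vector [g1 x, g2 x] :: real^2) \<bullet> i) has_derivative
      (\<lambda>d. vector [g1' d, g2' d] \<bullet> i)) (at x within S)"
    using assms by (auto simp: inner_axis vector_2)
qed

text \<open>Every slope \<open>p\<close> with \<open>norm p * diameter D < v z\<close> is attained by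
  the gradient at a point where the Hessian is negative semidefinite.\<close>

lemma abp_maximum_principle:
  fixes v :: "real^2 \<Rightarrow> real"
  assumes D: "open D" "bounded D" and cont: "continuous_on (closure D) v"
    and hess: "has_hessian_on D v g1 g2 h11 h12 h22"
    and bd: "\<And>x. x \<in> frontier D \<Longrightarrow> v x \<le> 0"
    and det: "\<And>x. x \<in> D \<Longrightarrow> h11 x \<le> 0 \<Longrightarrow> h22 x \<le> 0 \<Longrightarrow> (h12 x)\<^sup>2 \<le> h11 x * h22 x \<Longrightarrow>
      h11 x * h22 x - (h12 x)\<^sup>2 \<le> G x"
    and G: "G absolutely_integrable_on D" "\<And>x. x \<in> D \<Longrightarrow> 0 \<le> G x"
    and z: "z \<in> D"
  shows "v z \<le> diameter D * sqrt (integral D G / pi)"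
proof (rule ccontr)
  assume neg: "\<not> ?thesis"
  define d where "d = diameter D"
  define q where "q = sqrt (integral D G / pi)"
  have d0: "d \<ge> 0" using D by (simp add: d_def diameter_ge_0)
  have I0: "integral D G \<ge> 0" using G(2) by (intro integral_nonneg set_lebesgue_integral_eq_integral G) auto
  then have q0: "q \<ge> 0" by (simp add: q_def)
  have "v z > d * q" using neg by (simp add: d_def q_def)
  \<comment> \<open>A radius beyond the claimed bound, but small enough that tilting by a shorter
    slope cannot lift frontier values to \<open>v z\<close>. The area count will contradict
    \<open>\<rho> > q\<close>.\<close>
  then obtain \<rho> where \<rho>: "\<rho> > q" "\<rho> * d < v z"
  proof (cases "d = 0")
    case True
    then show ?thesis using that[of "q + 1"] \<open>v z > d * q\<close> by simp
  next
    case False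
    then have "q < v z / d" using d0 \<open>v z > d * q\<close> by (simp add: field_simps)
    then obtain \<rho> where "q < \<rho>" "\<rho> < v z / d" using dense by blast
    then show ?thesis using that[of \<rho>] False d0 by (simp add: field_simps)
  qed
  define g where "g = (\<lambda>x. vector [g1 x, g2 x] :: real^2)"
  define g' where "g' = (\<lambda>x (d::real^2). vector [h11 x * d $ 1 + h12 x * d $ 2, h12 x * d $ 1 + h22 x * d $ 2] :: real^2)"
  \<comment> \<open>A superset of the contact set that is relatively closed in \<open>D\<close>,
    hence measurable, and on which \<open>det\<close> still applies.\<close>
  define P where "P = {x \<in> D. h11 x \<le> 0 \<and> h22 x \<le> 0 \<and> (h12 x)\<^sup>2 - h11 x * h22 x \<le> 0}"
  have PD: "P \<subseteq> D" by (auto simp: P_def)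
  have h_cont: "continuous_on D h11" "continuous_on D h12" "continuous_on D h22"
    using hess by (auto simp: has_hessian_on_def)
  have "P = (D \<inter> h11 -` {..0}) \<inter> (D \<inter> h22 -` {..0}) \<inter> (D \<inter> (\<lambda>x. (h12 x)\<^sup>2 - h11 x * h22 x) -` {..0})"
    by (auto simp: P_def)
  also have "closedin (top_of_set D) \<dots>"
    by (intro closedin_Int continuous_closedin_preimage closed_atMost continuous_intros h_cont)
  finally have "closedin (top_of_set D) P" .
  then obtain T where "closed T" "P = D \<inter> T" using closedin_closed by blast
  then have P: "P \<in> sets lebesgue" using D(1) by auto
  have cover: "ball 0 \<rho> \<subseteq> g ` P"
  proof
    fix p :: "real^2" assume "p \<in> ball 0 \<rho>"
    then have p: "norm p < \<rho>" by simp
    \<comment> \<open>Tilt \<open>v\<close> about \<open>z\<close> by the slope \<open>p\<close>.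
      The tilted function still equals \<open>v z\<close> at \<open>z\<close>, while on the frontier
      it is at most \<open>norm p\<close> times the diameter; so its maximum is interior.\<close>
    have "\<exists>x\<in>closure D. \<forall>y\<in>closure D. v y - inner p (y - z) \<le> v x - inner p (x - z)"
      using D(2) z cont closure_subset[of D]
      by (intro continuous_attains_sup) (auto intro!: continuous_intros)
    then obtain x where x: "x \<in> closure D" "\<And>y. y \<in> closure D \<Longrightarrow> v y - inner p (y - z) \<le> v x - inner p (x - z)"
      by blast
    have "x \<notin> frontier D"
    proof
      assume fr: "x \<in> frontier D"
      have "dist x z \<le> d" unfolding d_def diameter_closure[OF D(2), symmetric]
        using x(1) z closure_subset D(2) by (intro diameter_bounded_bound) auto
      then have "norm p * norm (x - z) \<le> \<rho> * d"
        using p \<rho>(1) q0 by (intro mult_mono) (auto simp: dist_norm)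
      moreover have "- inner p (x - z) \<le> norm p * norm (x - z)"
        using Cauchy_Schwarz_ineq2[of p "x - z"] by linarith
      moreover have "v z \<le> v x - inner p (x - z)" using x(2)[of z] z closure_subset by auto
      ultimately show False using bd[OF fr] \<rho> by linarith
    qed
    then have xD: "x \<in> D" using x(1) D(1) by (simp add: frontier_def interior_open)
    have mx: "v y - inner p (y - z) \<le> v x - inner p (x - z)" if "y \<in> D" for y
      using x(2) that closure_subset by blast
    note H = hessian_at_interior_max[OF D(1) hess xD mx]
    have "g x = p" using H(1,2) by (simp add: g_def vec_eq_iff forall_2 vector_2)
    moreover have "x \<in> P" using H(3-5) xD by (simp add: P_def)
    ultimately show "p \<in> g ` P" by blast
  qed
  have der: "(g has_derivative g' x) (at x within P)" if "x \<in> P" for x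
    unfolding g_def g'_def using hess that PD unfolding has_hessian_on_def
    by (intro has_derivative_vector_2) (blast intro: has_derivative_at_withinI)+
  have detg: "det (matrix (g' x)) = h11 x * h22 x - (h12 x)\<^sup>2" for x
    by (simp add: det_2 matrix_def g'_def vector_2 axis_def power2_eq_square)
  have bound: "\<bar>det (matrix (g' x))\<bar> \<le> G x" if "x \<in> P" for x
    using det[of x] that by (auto simp: detg P_def)
  have GP: "G integrable_on P"
    by (intro set_lebesgue_integral_eq_integral set_integrable_subset[OF G(1) P PD])
  have "continuous_on P (\<lambda>x. \<bar>det (matrix (g' x))\<bar>)"
    unfolding detg by (intro continuous_intros continuous_on_subset[OF _ PD] h_cont)
  then have int: "(\<lambda>x. \<bar>det (matrix (g' x))\<bar>) integrable_on P"
    using bound P GP by (intro measurable_bounded_by_integrable_imp_integrable[OF _ GP _ P]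
        continuous_imp_measurable_on_sets_lebesgue) auto
  have "pi * \<rho>\<^sup>2 = measure lebesgue (ball (0::real^2) \<rho>)"
    using \<rho> q0 by (simp add: content_ball unit_ball_vol_2)
  also have "\<dots> \<le> measure lebesgue (g ` P)"
    using cover measurable_differentiable_image[OF P der int] by (intro measure_mono_fmeasurable) auto
  also have "\<dots> \<le> integral P (\<lambda>x. \<bar>det (matrix (g' x))\<bar>)"
    by (rule measure_differentiable_image[OF P der int])
  also have "\<dots> \<le> integral P G" using int GP bound by (rule integral_le)
  also have "\<dots> \<le> integral D G"
    using G(2) by (intro integral_subset_le PD GP set_lebesgue_integral_eq_integral(1)[OF G(1)] ballI)
  finally have "\<rho>\<^sup>2 \<le> integral D G / pi" by (simp add: field_simps)
  then have "\<rho> \<le> q" unfolding q_def by (rule real_le_rsqrt)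
  then show False using \<rho> by simp
qed

section \<open>Comparison principles for the Grushin operator\<close>

text \<open>This is the trace of a product of two positive semidefinite matrices. The first form at
  the vector \<open>(n11, n12)\<close> is at most \<open>n11\<close> times that trace.\<close>

lemma trace_prod_nonneg_2:
  fixes b11 b12 b22 n11 n12 n22 :: real
  assumes B: "\<And>s t. 0 \<le> b11 * s\<^sup>2 + b22 * t\<^sup>2 + 2 * b12 * s * t"
    and N: "0 \<le> n11" "0 \<le> n22" "n12\<^sup>2 \<le> n11 * n22"
  shows "0 \<le> b11 * n11 + 2 * b12 * n12 + b22 * n22"
proof -
  have b22: "0 \<le> b22" using B[of 0 1] by simp
  show ?thesis
  proof (cases "n11 = 0")
    case True
    then show ?thesis using N b22 by simp
  next
    case False
    have "0 \<le> b11 * n11\<^sup>2 + b22 * n12\<^sup>2 + 2 * b12 * n11 * n12" by (rule B)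
    also have "\<dots> \<le> b11 * n11\<^sup>2 + b22 * (n11 * n22) + 2 * b12 * n11 * n12"
      using N(3) b22 by (simp add: mult_left_mono)
    also have "\<dots> = n11 * (b11 * n11 + 2 * b12 * n12 + b22 * n22)"
      by (simp add: power2_eq_square algebra_simps)
    finally show ?thesis using False N(1) by (simp add: zero_le_mult_iff)
  qed
qed

text \<open>Let \<open>N\<close> be the negated Hessian with its second row and column scaled by
  \<open>x\<close>. The coefficient matrix minus \<open>lam\<close> times the identity is positive
  semidefinite, so \<open>lam\<close> times the trace of \<open>N\<close> is at most
  \<open>x^2 * \<bar>f\<bar>\<close>. Four times the determinant of \<open>N\<close> is at most its
  squared trace, and that determinant contains the factor \<open>x^2\<close>, which cancels. At
  \<open>x = 0\<close> the trace inequality forces \<open>h11 = 0\<close>, so the determinant is at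
  most 0.\<close>

lemma grushin_det_bound:
  fixes x f :: real
  assumes lam: "0 < lam"
    and A: "\<And>s t. lam * (s\<^sup>2 + t\<^sup>2) \<le> a11 * s\<^sup>2 + a22 * t\<^sup>2 + 2 * a12 * s * t"
    and H: "h11 \<le> 0" "h22 \<le> 0" "h12\<^sup>2 \<le> h11 * h22"
    and L: "- (x\<^sup>2 * \<bar>f\<bar>) \<le> a11 * h11 + 2 * a12 * x * h12 + a22 * x\<^sup>2 * h22"
  shows "h11 * h22 - h12\<^sup>2 \<le> (x * f)\<^sup>2 / (4 * lam\<^sup>2)"
proof -
  have "0 \<le> (a11 - lam) * (- h11) + 2 * a12 * (- x * h12) + (a22 - lam) * (- (x\<^sup>2 * h22))"
  proof (rule trace_prod_nonneg_2)
    show "0 \<le> (a11 - lam) * s\<^sup>2 + (a22 - lam) * t\<^sup>2 + 2 * a12 * s * t" for s t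
      using A[of s t] by (simp add: algebra_simps)
    show "(- x * h12)\<^sup>2 \<le> - h11 * (- (x\<^sup>2 * h22))"
      using mult_left_mono[OF H(3), of "x\<^sup>2"] by (simp add: power_mult_distrib algebra_simps)
  qed (use H in \<open>auto simp: mult_nonneg_nonpos\<close>)
  then have T: "lam * (- h11 - x\<^sup>2 * h22) \<le> x\<^sup>2 * \<bar>f\<bar>"
    using L by (simp add: algebra_simps)
  show ?thesis
  proof (cases "x = 0")
    case True
    then have "h11 = 0" using T H(1) lam by (simp add: zero_le_mult_iff)
    then show ?thesis using True by simp
  next
    case False
    have T0: "0 \<le> lam * (- h11 - x\<^sup>2 * h22)"
      using lam H(1) mult_nonneg_nonpos[OF zero_le_power2[of x] H(2)] by (intro mult_nonneg_nonneg) linarith+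
    have "4 * lam\<^sup>2 * x\<^sup>2 * (h11 * h22 - h12\<^sup>2) \<le> 4 * lam\<^sup>2 * x\<^sup>2 * (h11 * h22)"
      by (intro mult_left_mono) auto
    also have "\<dots> \<le> (lam * (- h11 - x\<^sup>2 * h22))\<^sup>2"
    proof -
      have "0 \<le> lam\<^sup>2 * (h11 - x\<^sup>2 * h22)\<^sup>2" by simp
      then show ?thesis by (simp add: power2_eq_square algebra_simps)
    qed
    also have "\<dots> \<le> (x\<^sup>2 * \<bar>f\<bar>)\<^sup>2" using T T0 by (rule power_mono)
    also have "\<dots> = x\<^sup>2 * (x * f)\<^sup>2" by (simp add: power_mult_distrib power2_eq_square)
    finally have "x\<^sup>2 * (4 * lam\<^sup>2 * (h11 * h22 - h12\<^sup>2)) \<le> x\<^sup>2 * (x * f)\<^sup>2"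
      by (simp add: ac_simps)
    then have "4 * lam\<^sup>2 * (h11 * h22 - h12\<^sup>2) \<le> (x * f)\<^sup>2"
      using False by (simp add: mult_le_cancel_left_pos)
    then show ?thesis using lam by (simp add: field_simps)
  qed
qed

section \<open>Grushin balls compared with coordinate boxes\<close>

lemma mem_grushin_ball_iff:
  "x \<in> grushin_ball y R \<longleftrightarrow> \<bar>x $ 1 - y $ 1\<bar> < R \<and>
     4 * \<bar>x $ 2 - y $ 2\<bar> < (R - \<bar>x $ 1 - y $ 1\<bar>)\<^sup>2 + 2 * (R - \<bar>x $ 1 - y $ 1\<bar>) * sqrt ((x $ 1)\<^sup>2 + (y $ 1)\<^sup>2)"
proof -
  define q where "q = sqrt ((x $ 1)\<^sup>2 + (y $ 1)\<^sup>2)"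
  define t where "t = R - \<bar>x $ 1 - y $ 1\<bar>"
  define b where "b = 4 * \<bar>x $ 2 - y $ 2\<bar>"
  have q: "q \<ge> 0" "(x $ 1)\<^sup>2 + (y $ 1)\<^sup>2 = q\<^sup>2" and b: "b \<ge> 0" by (auto simp: q_def b_def)
  have "x \<in> grushin_ball y R \<longleftrightarrow> sqrt (q\<^sup>2 + b) < t + q"
    unfolding grushin_ball_def grushin_dist_def mem_Collect_eq q(2) t_def b_def using q(1) by auto
  \<comment> \<open>Squaring \<open>sqrt (q^2 + b) < t + q\<close> cancels \<open>q^2\<close>, once
    the left side is known to force \<open>t > 0\<close>.\<close>
  also have "\<dots> \<longleftrightarrow> 0 < t \<and> b < t\<^sup>2 + 2 * t * q"
  proof
    assume l: "sqrt (q\<^sup>2 + b) < t + q"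
    have "q \<le> sqrt (q\<^sup>2 + b)" using b by (intro real_le_rsqrt) simp
    then have t: "0 < t" using l by linarith
    have "q\<^sup>2 + b < (t + q)\<^sup>2" using l b
      by (metis add_nonneg_nonneg real_sqrt_less_iff real_sqrt_unique zero_le_power2 l q(1) t less_eq_real_def)
    then show "0 < t \<and> b < t\<^sup>2 + 2 * t * q" using t by (simp add: power2_eq_square algebra_simps)
  next
    assume "0 < t \<and> b < t\<^sup>2 + 2 * t * q"
    then show "sqrt (q\<^sup>2 + b) < t + q" using q(1)
      by (intro real_less_lsqrt) (auto simp: power2_eq_square algebra_simps)
  qed
  finally show ?thesis by (simp add: t_def b_def q_def)
qed

lemma open_grushin_ball: "open (grushin_ball y R)"
  unfolding grushin_ball_def grushin_dist_def
  by (intro open_Collect_less continuous_intros)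

lemma sqrt_sum_squares_le_shift: "sqrt (a\<^sup>2 + b\<^sup>2) \<le> \<bar>a - b\<bar> + 2 * \<bar>b\<bar>" for a b :: real
  using sqrt_sum_squares_le_sum_abs[of a b] by linarith

text \<open>The square root is at most of order \<open>R + \<bar>y $ 1\<bar>\<close> on the ball, so
  the vertical extent is of order \<open>R * (R + \<bar>y $ 1\<bar>)\<close>. This is the scale of
  the second normalised coordinate.\<close>

lemma grushin_ball_subset_box:
  assumes "x \<in> grushin_ball y R"
  shows "\<bar>x $ 1 - y $ 1\<bar> < R" "\<bar>x $ 2 - y $ 2\<bar> < R * (R + \<bar>y $ 1\<bar>)"
proof -
  define a where "a = \<bar>x $ 1 - y $ 1\<bar>"
  note x = assms[unfolded mem_grushin_ball_iff, folded a_def]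
  show "\<bar>x $ 1 - y $ 1\<bar> < R" using x a_def by simp
  have a: "0 \<le> a" "a < R" using x a_def by auto
  have "(R - a)\<^sup>2 + 2 * (R - a) * sqrt ((x $ 1)\<^sup>2 + (y $ 1)\<^sup>2) \<le> R\<^sup>2 + 2 * R * (R + 2 * \<bar>y $ 1\<bar>)"
    using a sqrt_sum_squares_le_shift[of "x $ 1" "y $ 1"] a_def
    by (intro add_mono mult_mono power_mono) auto
  then have "4 * \<bar>x $ 2 - y $ 2\<bar> < R\<^sup>2 + 2 * R * (R + 2 * \<bar>y $ 1\<bar>)" using x by linarith
  also have "\<dots> \<le> 4 * (R * (R + \<bar>y $ 1\<bar>))" by (simp add: power2_eq_square algebra_simps)
  finally show "\<bar>x $ 2 - y $ 2\<bar> < R * (R + \<bar>y $ 1\<bar>)" by simp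
qed

lemma bounded_grushin_ball: "bounded (grushin_ball y R)"
proof -
  have "norm x \<le> \<bar>y $ 1\<bar> + R + (\<bar>y $ 2\<bar> + R * (R + \<bar>y $ 1\<bar>))" if "x \<in> grushin_ball y R" for x
  proof -
    have "norm x \<le> \<bar>x $ 1\<bar> + \<bar>x $ 2\<bar>" using norm_le_l1_cart[of x] by (simp add: sum_2)
    then show ?thesis using grushin_ball_subset_box[OF that] by linarith
  qed
  then show ?thesis unfolding bounded_iff by blast
qed

text \<open>Origin of the enlargement factor 23. After a horizontal move of at most
  \<open>10 * r\<close> a radius of at least \<open>13 * r\<close> remains, and its linear part
  \<open>26 * r * \<bar>y $ 1\<bar>\<close> covers the required
  \<open>24 * r * \<bar>y $ 1\<bar>\<close>. All barriers live in the box with half-widths 10 and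
  6.\<close>

lemma box_subset_grushin_ball:
  assumes r: "0 < r" and x: "\<bar>x $ 1 - y $ 1\<bar> \<le> 10 * r" "\<bar>x $ 2 - y $ 2\<bar> \<le> 6 * (r * (r + \<bar>y $ 1\<bar>))"
  shows "x \<in> grushin_ball y (23 * r)"
  unfolding mem_grushin_ball_iff
proof
  show "\<bar>x $ 1 - y $ 1\<bar> < 23 * r" using x(1) r by linarith
  define t where "t = 23 * r - \<bar>x $ 1 - y $ 1\<bar>"
  have t: "13 * r \<le> t" using x(1) by (simp add: t_def)
  have "\<bar>y $ 1\<bar> \<le> sqrt ((x $ 1)\<^sup>2 + (y $ 1)\<^sup>2)" by (rule real_le_rsqrt) simp
  then have "(13 * r)\<^sup>2 + 2 * (13 * r) * \<bar>y $ 1\<bar> \<le> t\<^sup>2 + 2 * t * sqrt ((x $ 1)\<^sup>2 + (y $ 1)\<^sup>2)"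
    using t r by (intro add_mono mult_mono power_mono) auto
  moreover have "4 * (6 * (r * (r + \<bar>y $ 1\<bar>))) < (13 * r)\<^sup>2 + 2 * (13 * r) * \<bar>y $ 1\<bar>"
    using r by (simp add: power2_eq_square algebra_simps add_strict_increasing2)
  ultimately show "4 * \<bar>x $ 2 - y $ 2\<bar> < (23 * r - \<bar>x $ 1 - y $ 1\<bar>)\<^sup>2
      + 2 * (23 * r - \<bar>x $ 1 - y $ 1\<bar>) * sqrt ((x $ 1)\<^sup>2 + (y $ 1)\<^sup>2)"
    using x(2) by (simp add: t_def)
qed

section \<open>Exponential barriers\<close>

lemma has_derivative_vec_nth_comp [derivative_intros]:
  "((\<lambda>x. x $ i) has_derivative (\<lambda>d. d $ i)) F"
  by (rule bounded_linear.has_derivative[OF bounded_linear_vec_nth has_derivative_ident])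

lemma has_hessian_on_const: "has_hessian_on S (\<lambda>x. k) (\<lambda>x. 0) (\<lambda>x. 0) (\<lambda>x. 0) (\<lambda>x. 0) (\<lambda>x. 0)"
  by (simp add: has_hessian_on_def)

lemma has_hessian_on_diff:
  assumes v: "has_hessian_on S v g1 g2 h11 h12 h22" and w: "has_hessian_on S w k1 k2 l11 l12 l22"
  shows "has_hessian_on S (\<lambda>x. v x - w x) (\<lambda>x. g1 x - k1 x) (\<lambda>x. g2 x - k2 x)
    (\<lambda>x. h11 x - l11 x) (\<lambda>x. h12 x - l12 x) (\<lambda>x. h22 x - l22 x)"
proof -
  have diff: "((\<lambda>x. a x - b x) has_derivative (\<lambda>d. (s - s') * d $ 1 + (t - t') * d $ 2)) (at x)"
    if "(a has_derivative (\<lambda>d. s * d $ 1 + t * d $ 2)) (at x)"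
      "(b has_derivative (\<lambda>d. s' * d $ 1 + t' * d $ 2)) (at x)"
    for a b :: "real^2 \<Rightarrow> real" and s t s' t' x
    using has_derivative_diff[OF that] by (simp add: algebra_simps)
  show ?thesis
    using v w unfolding has_hessian_on_def
    by (intro conjI ballI continuous_on_diff diff) simp_all
qed

text \<open>One family for both orientations: linear growth in the direction of travel and a concave
  quadratic penalty across it, which closes the positivity region sideways. The exponential adds the
  squared gradient of the exponent to the second derivatives, and this has to beat the
  concavity.\<close>

definition barrier_exp :: "real \<Rightarrow> real \<Rightarrow> real \<Rightarrow> real \<Rightarrow> real \<Rightarrow> real \<Rightarrow> real^2 \<Rightarrow> real" where
  "barrier_exp p1 q1 c1 p2 q2 c2 x =
     exp (p1 * (x $ 1 - c1) - q1 * (x $ 1 - c1)\<^sup>2 + (p2 * (x $ 2 - c2) - q2 * (x $ 2 - c2)\<^sup>2))"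

lemma barrier_has_hessian_on:
  fixes \<mu> \<kappa> p1 q1 c1 p2 q2 c2 :: real
  defines "W \<equiv> barrier_exp p1 q1 c1 p2 q2 c2"
    and "A \<equiv> \<lambda>x::real^2. p1 - 2 * q1 * (x $ 1 - c1)" and "B \<equiv> \<lambda>x::real^2. p2 - 2 * q2 * (x $ 2 - c2)"
  shows "has_hessian_on S (\<lambda>x. \<mu> * (W x - \<kappa>)) (\<lambda>x. \<mu> * (W x * A x)) (\<lambda>x. \<mu> * (W x * B x))
    (\<lambda>x. \<mu> * (W x * ((A x)\<^sup>2 - 2 * q1))) (\<lambda>x. \<mu> * (W x * (A x * B x))) (\<lambda>x. \<mu> * (W x * ((B x)\<^sup>2 - 2 * q2)))"
proof -
  have W: "(W has_derivative (\<lambda>d. W x * (A x * d $ 1 + B x * d $ 2))) (at x)" for x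
    unfolding W_def barrier_exp_def[abs_def] A_def B_def
    by (auto intro!: derivative_eq_intros simp: algebra_simps power2_eq_square)
  have A: "(A has_derivative (\<lambda>d. - 2 * q1 * d $ 1)) (at x)" for x
    unfolding A_def by (auto intro!: derivative_eq_intros)
  have B: "(B has_derivative (\<lambda>d. - 2 * q2 * d $ 2)) (at x)" for x
    unfolding B_def by (auto intro!: derivative_eq_intros)
  have [continuous_intros]: "continuous_on S W" "continuous_on S A" "continuous_on S B"
    unfolding W_def barrier_exp_def[abs_def] A_def B_def by (intro continuous_intros)+
  show ?thesis unfolding has_hessian_on_def
    by (intro conjI ballI continuous_intros)
      (auto intro!: derivative_eq_intros W A B simp: algebra_simps power2_eq_square)
qed

section \<open>Maximum principle for one solution on one ball\<close>

locale grushin_solution =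
  fixes lam Lam :: real and \<Omega> :: "(real^2) set" and a11 a12 a22 f u :: "real^2 \<Rightarrow> real"
    and y :: "real^2" and r :: real
  assumes lam: "0 < lam" "lam \<le> Lam"
    and open_\<Omega>: "open \<Omega>" and coeffs: "grushin_coeffs \<Omega> lam Lam a11 a12 a22"
    and f_meas: "f \<in> borel_measurable (lebesgue_on \<Omega>)" and f_bdd: "bounded (f ` \<Omega>)"
    and u_C2: "Ck_on 2 \<Omega> u" and u_nonneg: "\<And>x. x \<in> \<Omega> \<Longrightarrow> 0 \<le> u x"
    and u_eq: "\<And>x. x \<in> \<Omega> \<Longrightarrow> grushin_op a11 a12 a22 u x = (x $ 1)\<^sup>2 * f x"
    and r: "0 < r" and ball_subset: "grushin_ball y (23 * r) \<subseteq> \<Omega>"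
begin

abbreviation "B \<equiv> grushin_ball y (23 * r)"

text \<open>The Aleksandrov-Bakelman-Pucci bound with \<open>G = (x_1 f)^2 / (4 lam^2)\<close>,
  taken over the whole ball so that every subdomain has the same error.\<close>

definition err :: real where
  "err = diameter B * L2_norm_on B (\<lambda>x. x $ 1 * f x) / (2 * lam * sqrt pi)"

lemma elliptic:
  assumes "x \<in> \<Omega>"
  shows "lam * (s\<^sup>2 + t\<^sup>2) \<le> a11 x * s\<^sup>2 + a22 x * t\<^sup>2 + 2 * a12 x * s * t"
    and "a11 x * s\<^sup>2 + a22 x * t\<^sup>2 + 2 * a12 x * s * t \<le> Lam * (s\<^sup>2 + t\<^sup>2)"
proof -
  have "(norm (vector [s, t] :: real^2))\<^sup>2 = s\<^sup>2 + t\<^sup>2"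
    by (simp add: norm_vec_def L2_set_def sum_2 vector_2)
  then show "lam * (s\<^sup>2 + t\<^sup>2) \<le> a11 x * s\<^sup>2 + a22 x * t\<^sup>2 + 2 * a12 x * s * t"
    "a11 x * s\<^sup>2 + a22 x * t\<^sup>2 + 2 * a12 x * s * t \<le> Lam * (s\<^sup>2 + t\<^sup>2)"
    using coeffs assms unfolding grushin_coeffs_def by (metis vector_2)+
qed

lemma diag_le_Lam: "x \<in> \<Omega> \<Longrightarrow> a11 x \<le> Lam" "x \<in> \<Omega> \<Longrightarrow> a22 x \<le> Lam"
  using elliptic(2)[of x 1 0] elliptic(2)[of x 0 1] by auto

lemma square_integrable: "(\<lambda>x. (x $ 1 * f x)\<^sup>2) absolutely_integrable_on B"
proof -
  obtain c where c: "\<And>x. x \<in> \<Omega> \<Longrightarrow> \<bar>f x\<bar> \<le> c" using f_bdd unfolding bounded_iff by auto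
  obtain R where R: "\<And>x. x \<in> B \<Longrightarrow> norm x \<le> R" using bounded_grushin_ball unfolding bounded_iff by blast
  show ?thesis
  proof (rule measurable_bounded_by_integrable_imp_absolutely_integrable)
    show B: "B \<in> sets lebesgue" using open_grushin_ball by auto
    have "f \<in> borel_measurable (lebesgue_on B)"
      using measurable_restrict_mono[OF f_meas ball_subset] .
    moreover have "(\<lambda>x::real^2. x $ 1) \<in> borel_measurable (lebesgue_on B)"
      using B by (intro continuous_imp_measurable_on_sets_lebesgue continuous_intros)
    ultimately show "(\<lambda>x. (x $ 1 * f x)\<^sup>2) \<in> borel_measurable (lebesgue_on B)" by measurable
    show "(\<lambda>x. (R * c)\<^sup>2) integrable_on B"
      using bounded_grushin_ball open_grushin_ball
      by (intro integrable_on_const lmeasurable_open)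
    fix x assume x: "x \<in> B"
    have "\<bar>x $ 1 * f x\<bar> \<le> R * c" unfolding abs_mult
      using R[OF x] c[of x] component_le_norm_cart[of x 1] x ball_subset
      by (intro mult_mono) auto
    then have "\<bar>x $ 1 * f x\<bar>\<^sup>2 \<le> (R * c)\<^sup>2" by (intro power_mono) auto
    then show "norm ((x $ 1 * f x)\<^sup>2) \<le> (R * c)\<^sup>2" by simp
  qed
qed

text \<open>The one-sided inequality with \<open>\<bar>f x\<bar>\<close> fits both \<open>u\<close>
  minus a constant and a barrier minus \<open>u\<close>, whose right-hand sides have opposite
  signs.\<close>

lemma maximum_principle:
  assumes D: "open D" "closure D \<subseteq> B" and cont: "continuous_on (closure D) v"
    and hess: "has_hessian_on D v g1 g2 h11 h12 h22"
    and sub: "\<And>x. x \<in> D \<Longrightarrow> - ((x $ 1)\<^sup>2 * \<bar>f x\<bar>) \<le>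
      a11 x * h11 x + 2 * a12 x * x $ 1 * h12 x + a22 x * (x $ 1)\<^sup>2 * h22 x"
    and bd: "\<And>x. x \<in> frontier D \<Longrightarrow> v x \<le> 0" and z: "z \<in> D"
  shows "v z \<le> err"
proof -
  let ?G = "\<lambda>x. (x $ 1 * f x)\<^sup>2 / (4 * lam\<^sup>2)"
  have DB: "D \<subseteq> B" using D(2) closure_subset by blast
  have G: "?G absolutely_integrable_on B"
    by (intro set_integrable_divide square_integrable)
  have GD: "?G absolutely_integrable_on D"
    using D(1) by (intro set_integrable_subset[OF G] DB) auto
  have "v z \<le> diameter D * sqrt (integral D ?G / pi)"
  proof (rule abp_maximum_principle[OF D(1) _ cont hess bd _ GD _ z])
    show "bounded D" using bounded_grushin_ball DB bounded_subset by blast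
    fix x assume x: "x \<in> D" and "h11 x \<le> 0" "h22 x \<le> 0" "(h12 x)\<^sup>2 \<le> h11 x * h22 x"
    then show "h11 x * h22 x - (h12 x)\<^sup>2 \<le> ?G x"
      using DB ball_subset by (intro grushin_det_bound[OF lam(1) elliptic(1) _ _ _ sub]) auto
  qed auto
  also have "\<dots> \<le> diameter B * sqrt (integral B ?G / pi)"
  proof (intro mult_mono real_sqrt_le_mono divide_right_mono)
    show "diameter D \<le> diameter B" using DB bounded_grushin_ball by (rule diameter_subset)
    show "integral D ?G \<le> integral B ?G"
      by (intro integral_subset_le DB set_lebesgue_integral_eq_integral(1)[OF G]
          set_lebesgue_integral_eq_integral(1)[OF GD]) auto
    show "0 \<le> diameter B" using bounded_grushin_ball by (rule diameter_ge_0)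
    show "0 \<le> sqrt (integral D ?G / pi)"
      by (intro real_sqrt_ge_zero divide_nonneg_nonneg integral_nonneg
          set_lebesgue_integral_eq_integral(1)[OF GD]) auto
  qed auto
  also have "sqrt (integral B ?G / pi) = L2_norm_on B (\<lambda>x. x $ 1 * f x) / (2 * lam * sqrt pi)"
  proof -
    have "integral B ?G = (LINT x:B|lebesgue. (x $ 1 * f x)\<^sup>2) / (4 * lam\<^sup>2)"
      by (simp only: integral_divide set_lebesgue_integral_eq_integral(2)[OF square_integrable])
    then show ?thesis using lam
      by (simp add: L2_norm_on_def real_sqrt_divide real_sqrt_mult)
  qed
  finally show ?thesis by (simp add: err_def)
qed

lemma u_has_hessian: "has_hessian_on \<Omega> u (partial 1 u) (partial 2 u) (partial 1 (partial 1 u))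
    (partial 2 (partial 1 u)) (partial 2 (partial 2 u))"
  using open_\<Omega> u_C2 by (rule Ck_on_2_has_hessian_on)

lemma u_cont: "continuous_on \<Omega> u"
  using u_has_hessian by (rule has_hessian_on_continuous)

lemma Lu_eq:
  assumes "x \<in> \<Omega>"
  shows "a11 x * partial 1 (partial 1 u) x + 2 * a12 x * x $ 1 * partial 2 (partial 1 u) x
    + a22 x * (x $ 1)\<^sup>2 * partial 2 (partial 2 u) x = (x $ 1)\<^sup>2 * f x"
  using grushin_op_Ck_on[OF open_\<Omega> u_C2 assms] u_eq[OF assms] by simp

lemma err_nonneg: "0 \<le> err"
  using lam by (simp add: err_def L2_norm_on_def diameter_ge_0[OF bounded_grushin_ball] set_lebesgue_integral_def)

lemma u_le_frontier:
  assumes D: "open D" "closure D \<subseteq> B" and bd: "\<And>x. x \<in> frontier D \<Longrightarrow> u x \<le> k" and z: "z \<in> D"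
  shows "u z \<le> k + err"
proof -
  have DO: "D \<subseteq> \<Omega>" and CO: "closure D \<subseteq> \<Omega>" using D(2) ball_subset closure_subset by blast+
  have "u z - k \<le> err"
  proof (rule maximum_principle[OF D _ _ _ _ z])
    show "continuous_on (closure D) (\<lambda>x. u x - k)"
      by (intro continuous_intros continuous_on_subset[OF u_cont CO])
    show "has_hessian_on D (\<lambda>x. u x - k) (partial 1 u) (partial 2 u) (partial 1 (partial 1 u))
      (partial 2 (partial 1 u)) (partial 2 (partial 2 u))"
      using has_hessian_on_diff[OF has_hessian_on_subset[OF u_has_hessian DO] has_hessian_on_const]
      unfolding diff_0_right .
    fix x assume "x \<in> D"
    have "(x $ 1)\<^sup>2 * - \<bar>f x\<bar> \<le> (x $ 1)\<^sup>2 * f x" by (intro mult_left_mono) auto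
    then show "- ((x $ 1)\<^sup>2 * \<bar>f x\<bar>) \<le> a11 x * partial 1 (partial 1 u) x
        + 2 * a12 x * x $ 1 * partial 2 (partial 1 u) x + a22 x * (x $ 1)\<^sup>2 * partial 2 (partial 2 u) x"
      using Lu_eq \<open>x \<in> D\<close> DO by auto
  qed (use bd in auto)
  then show ?thesis by simp
qed

text \<open>Up to the positive factor \<open>\<mu> * W\<close>, applying \<open>L\<close> to
  \<open>w\<close> gives the quadratic form at the gradient of the exponent minus twice the penalty
  terms. Ellipticity and \<open>sub\<close> make this nonnegative, so only the contribution of
  \<open>f\<close> remains for \<open>w - u\<close>.\<close>

lemma barrier_le_u:
  fixes \<mu> \<kappa> p1 q1 c1 p2 q2 c2 :: real
  defines "w \<equiv> \<lambda>x. \<mu> * (barrier_exp p1 q1 c1 p2 q2 c2 x - \<kappa>)"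
  assumes D: "open D" "closure D \<subseteq> B" and \<mu>: "0 \<le> \<mu>" and q: "0 \<le> q1" "0 \<le> q2"
    and sub: "\<And>x. x \<in> D \<Longrightarrow> 2 * Lam * (q1 + (x $ 1)\<^sup>2 * q2) \<le>
      lam * ((p1 - 2 * q1 * (x $ 1 - c1))\<^sup>2 + (x $ 1)\<^sup>2 * (p2 - 2 * q2 * (x $ 2 - c2))\<^sup>2)"
    and bd: "\<And>x. x \<in> frontier D \<Longrightarrow> w x \<le> u x" and z: "z \<in> D"
  shows "w z \<le> u z + err"
proof -
  have DO: "D \<subseteq> \<Omega>" and CO: "closure D \<subseteq> \<Omega>" using D(2) ball_subset closure_subset by blast+
  define W where "W = barrier_exp p1 q1 c1 p2 q2 c2"
  define A1 where "A1 = (\<lambda>x::real^2. p1 - 2 * q1 * (x $ 1 - c1))"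
  define B1 where "B1 = (\<lambda>x::real^2. p2 - 2 * q2 * (x $ 2 - c2))"
  have hw: "has_hessian_on S w (\<lambda>x. \<mu> * (W x * A1 x)) (\<lambda>x. \<mu> * (W x * B1 x))
    (\<lambda>x. \<mu> * (W x * ((A1 x)\<^sup>2 - 2 * q1))) (\<lambda>x. \<mu> * (W x * (A1 x * B1 x)))
    (\<lambda>x. \<mu> * (W x * ((B1 x)\<^sup>2 - 2 * q2)))" for S
    unfolding w_def W_def A1_def B1_def by (rule barrier_has_hessian_on)
  have "w z - u z \<le> err"
  proof (rule maximum_principle[OF D _ _ _ _ z])
    show "continuous_on (closure D) (\<lambda>x. w x - u x)"
      by (intro continuous_intros continuous_on_subset[OF u_cont CO] has_hessian_on_continuous[OF hw])
    show "has_hessian_on D (\<lambda>x. w x - u x)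
      (\<lambda>x. \<mu> * (W x * A1 x) - partial 1 u x) (\<lambda>x. \<mu> * (W x * B1 x) - partial 2 u x)
      (\<lambda>x. \<mu> * (W x * ((A1 x)\<^sup>2 - 2 * q1)) - partial 1 (partial 1 u) x)
      (\<lambda>x. \<mu> * (W x * (A1 x * B1 x)) - partial 2 (partial 1 u) x)
      (\<lambda>x. \<mu> * (W x * ((B1 x)\<^sup>2 - 2 * q2)) - partial 2 (partial 2 u) x)"
      by (rule has_hessian_on_diff[OF hw has_hessian_on_subset[OF u_has_hessian DO]])
    fix x assume xD: "x \<in> D"
    then have x: "x \<in> \<Omega>" using DO by blast
    have "0 \<le> lam * ((A1 x)\<^sup>2 + (x $ 1)\<^sup>2 * (B1 x)\<^sup>2) - 2 * Lam * (q1 + (x $ 1)\<^sup>2 * q2)"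
      using sub[OF xD] by (simp add: A1_def B1_def)
    also have "\<dots> \<le> a11 x * (A1 x)\<^sup>2 + a22 x * (x $ 1 * B1 x)\<^sup>2 + 2 * a12 x * A1 x * (x $ 1 * B1 x)
        - 2 * (a11 x * q1 + a22 x * ((x $ 1)\<^sup>2 * q2))"
    proof -
      have "a11 x * q1 \<le> Lam * q1" "a22 x * ((x $ 1)\<^sup>2 * q2) \<le> Lam * ((x $ 1)\<^sup>2 * q2)"
        using diag_le_Lam[OF x] q by (auto intro!: mult_right_mono)
      then show ?thesis using elliptic(1)[OF x, of "A1 x" "x $ 1 * B1 x"]
        by (simp add: algebra_simps power_mult_distrib)
    qed
    also have "\<dots> = a11 x * ((A1 x)\<^sup>2 - 2 * q1) + 2 * a12 x * x $ 1 * (A1 x * B1 x)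
        + a22 x * (x $ 1)\<^sup>2 * ((B1 x)\<^sup>2 - 2 * q2)"
      by (simp add: algebra_simps power_mult_distrib)
    finally have "0 \<le> \<mu> * W x * (a11 x * ((A1 x)\<^sup>2 - 2 * q1) + 2 * a12 x * x $ 1 * (A1 x * B1 x)
        + a22 x * (x $ 1)\<^sup>2 * ((B1 x)\<^sup>2 - 2 * q2))"
      using \<mu> by (intro mult_nonneg_nonneg) (auto simp: W_def barrier_exp_def)
    moreover have "(x $ 1)\<^sup>2 * f x \<le> (x $ 1)\<^sup>2 * \<bar>f x\<bar>" by (intro mult_left_mono) auto
    ultimately show "- ((x $ 1)\<^sup>2 * \<bar>f x\<bar>) \<le>
        a11 x * (\<mu> * (W x * ((A1 x)\<^sup>2 - 2 * q1)) - partial 1 (partial 1 u) x)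
        + 2 * a12 x * x $ 1 * (\<mu> * (W x * (A1 x * B1 x)) - partial 2 (partial 1 u) x)
        + a22 x * (x $ 1)\<^sup>2 * (\<mu> * (W x * ((B1 x)\<^sup>2 - 2 * q2)) - partial 2 (partial 2 u) x)"
      using Lu_eq[OF x] by (simp add: algebra_simps)
  qed (use bd in auto)
  then show ?thesis by simp
qed

end

section \<open>Crossing paths\<close>

text \<open>\<open>fashoda\<close> wants both paths inside a rectangle with their ends on opposite
  sides. Clamping both coordinates to the rectangle achieves this without cutting the paths.\<close>

lemma crossing_paths_meet:
  fixes f g :: "real \<Rightarrow> 'a::topological_space" and P Q :: "'a \<Rightarrow> real"
  assumes f: "path f" and g: "path g" and P: "continuous_on UNIV P" and Q: "continuous_on UNIV Q"
    and fP: "\<And>x. x \<in> path_image f \<Longrightarrow> a1 < P x \<and> P x < b1"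
    and gQ: "\<And>x. x \<in> path_image g \<Longrightarrow> a2 < Q x \<and> Q x < b2"
    and fQ: "Q (pathstart f) \<le> a2" "b2 \<le> Q (pathfinish f)"
    and gP: "P (pathstart g) \<le> a1" "b1 \<le> P (pathfinish g)"
  obtains x x' where "x \<in> path_image f" "x' \<in> path_image g" "P x = P x'" "Q x = Q x'"
proof -
  define cl where "cl = (\<lambda>x. vector [max a1 (min b1 (P x)), max a2 (min b2 (Q x))] :: real^2)"
  have ab: "a1 < b1" "a2 < b2"
    using fP[OF pathstart_in_path_image] gQ[OF pathstart_in_path_image] by force+
  have "continuous_on UNIV (\<lambda>x. cl x $ i)" for i
  proof -
    have "continuous_on UNIV (\<lambda>x. max a1 (min b1 (P x)))" "continuous_on UNIV (\<lambda>x. max a2 (min b2 (Q x)))"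
      by (intro continuous_intros P Q)+
    then show ?thesis using exhaust_2[of i] unfolding cl_def by (auto simp: vector_2)
  qed
  then have cl: "continuous_on UNIV cl"
    using continuous_on_vec_lambda[of UNIV "\<lambda>i x. cl x $ i"] by simp
  then have "path (cl \<circ> f)" "path (cl \<circ> g)"
    using f g by (auto intro!: path_continuous_image intro: continuous_on_subset)
  moreover have "range cl \<subseteq> cbox (vector [a1, a2]) (vector [b1, b2])"
    using ab by (auto simp: cl_def mem_box_cart forall_2 vector_2)
  then have "path_image (cl \<circ> h) \<subseteq> cbox (vector [a1, a2]) (vector [b1, b2])" for h
    unfolding path_image_compose by blast
  moreover have "pathstart (cl \<circ> g) $ 1 = (vector [a1, a2] :: real^2) $ 1"
    "pathfinish (cl \<circ> g) $ 1 = (vector [b1, b2] :: real^2) $ 1"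
    "pathstart (cl \<circ> f) $ 2 = (vector [a1, a2] :: real^2) $ 2"
    "pathfinish (cl \<circ> f) $ 2 = (vector [b1, b2] :: real^2) $ 2"
    using fQ gP ab by (auto simp: pathstart_compose pathfinish_compose cl_def vector_2)
  ultimately obtain z where "z \<in> path_image (cl \<circ> g)" "z \<in> path_image (cl \<circ> f)"
    using fashoda[of "cl \<circ> g" "cl \<circ> f" "vector [a1, a2]" "vector [b1, b2]"] by metis
  then obtain x x' where x: "x \<in> path_image f" "x' \<in> path_image g" "cl x = cl x'"
    by (auto simp: path_image_compose)
  then have "max a1 (min b1 (P x)) = max a1 (min b1 (P x'))"
    "max a2 (min b2 (Q x)) = max a2 (min b2 (Q x'))"
    by (auto simp: cl_def vec_eq_iff forall_2 vector_2)
  \<comment> \<open>Along \<open>f\<close> the value of \<open>P\<close>, and along \<open>g\<close>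
    the value of \<open>Q\<close>, lies strictly inside its interval. Equality of clamped values
    then shows that the other path was not clamped in that coordinate either.\<close>
  then have "P x = P x'" "Q x = Q x'" using fP[OF x(1)] gQ[OF x(2)] by (auto simp: max_def min_def split: if_splits)
  then show thesis using x that by blast
qed

text \<open>Source of the boundary inequalities in all comparisons: on the frontier of a component
  of a level set the defining strict inequality fails.\<close>

lemma frontier_component_disjoint:
  fixes S :: "'a::real_normed_vector set"
  assumes "open S" "x \<in> frontier (connected_component_set S z)"
  shows "x \<notin> S"
  using assms frontier_of_connected_component_subset[of S z] by (auto simp: frontier_def interior_open)

lemma path_in_component:
  fixes S :: "'a::real_normed_vector set"
  assumes S: "open S" and q: "q \<in> connected_component_set S z"
  obtains g where "path g" "path_image g \<subseteq> S" "pathstart g = z" "pathfinish g = q"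
proof -
  have "z \<in> connected_component_set S z" using q connected_component_in connected_component_refl by fastforce
  moreover have "path_connected (connected_component_set S z)"
    using S by (intro connected_open_path_connected open_connected_component connected_connected_component)
  ultimately obtain g where "path g" "path_image g \<subseteq> connected_component_set S z"
    "pathstart g = z" "pathfinish g = q" using q unfolding path_connected_def by blast
  then show thesis using that connected_component_subset by blast
qed

section \<open>Escaping level sets and lower bounds from barriers\<close>

context grushin_solution
begin

lemma u_nonneg_B: "x \<in> B \<Longrightarrow> 0 \<le> u x"
  using u_nonneg ball_subset by blast

lemma u_cont_B: "S \<subseteq> B \<Longrightarrow> continuous_on S u"
  using u_cont ball_subset continuous_on_subset by blast

text \<open>A component trapped in \<open>K\<close> would have \<open>u \<le> k\<close> on its
  frontier, and the maximum principle would bound \<open>u z\<close>. Having \<open>K\<close> inside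
  \<open>U\<close> keeps that frontier away from the frontier of \<open>U\<close>, where nothing is
  known.\<close>

lemma superlevel_escape:
  assumes U: "open U" "U \<subseteq> B" and K: "closed K" "K \<subseteq> U" and z: "z \<in> U" "k + err < u z"
  obtains g where "path g" "path_image g \<subseteq> {x \<in> U. k < u x}" "pathstart g = z" "pathfinish g \<notin> K"
proof -
  define S where "S = {x \<in> U. k < u x}"
  have "open (U \<inter> u -` {k<..})" using u_cont_B[OF U(2)] U(1) by (intro continuous_open_preimage) auto
  moreover have "U \<inter> u -` {k<..} = S" by (auto simp: S_def)
  ultimately have S: "open S" by simp
  have zS: "z \<in> S" using z err_nonneg by (simp add: S_def)
  let ?C = "connected_component_set S z"
  have "\<not> ?C \<subseteq> K"
  proof
    assume C: "?C \<subseteq> K"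
    then have cl: "closure ?C \<subseteq> K" using K(1) by (rule closure_minimal)
    have "u z \<le> k + err"
    proof (rule u_le_frontier[OF open_connected_component[OF S]])
      show "closure ?C \<subseteq> B" using cl K U by blast
      show "z \<in> ?C" using zS by simp
      fix x assume x: "x \<in> frontier ?C"
      then have "x \<in> U" using cl K by (auto simp: frontier_def)
      then show "u x \<le> k" using frontier_component_disjoint[OF S x] by (auto simp: S_def)
    qed
    then show False using z by simp
  qed
  then obtain q where "q \<in> ?C" "q \<notin> K" by blast
  then obtain g where "path g" "path_image g \<subseteq> S" "pathstart g = z" "pathfinish g = q"
    using path_in_component[OF S] by blast
  then show thesis using \<open>q \<notin> K\<close> unfolding S_def by (intro that) auto
qed

text \<open>The comparison principle as a property of \<open>w\<close>, so that the path arguments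
  run for either orientation. \<open>T\<close> records where the differential inequality is
  available; the closure of \<open>D\<close> only has to stay in the ball.\<close>

definition lower_barrier :: "(real^2) set \<Rightarrow> (real^2 \<Rightarrow> real) \<Rightarrow> bool" where
  "lower_barrier T w \<longleftrightarrow> (\<forall>D. open D \<longrightarrow> D \<subseteq> T \<longrightarrow> closure D \<subseteq> B \<longrightarrow>
     (\<forall>x\<in>frontier D. w x \<le> u x) \<longrightarrow> (\<forall>z\<in>D. w z \<le> u z + err))"

lemma lower_barrierD:
  "lower_barrier T w \<Longrightarrow> open D \<Longrightarrow> D \<subseteq> T \<Longrightarrow> closure D \<subseteq> B \<Longrightarrow>
    (\<And>x. x \<in> frontier D \<Longrightarrow> w x \<le> u x) \<Longrightarrow> z \<in> D \<Longrightarrow> w z \<le> u z + err"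
  unfolding lower_barrier_def by blast

text \<open>Counterpart of \<open>superlevel_escape\<close> with a barrier as the moving level: a
  trapped component of \<open>u < w\<close> would have \<open>w \<le> u\<close> on its frontier, and
  comparison would contradict the gap at \<open>z\<close>.\<close>

lemma sublevel_escape:
  assumes U: "open U" "U \<subseteq> B" and K: "closed K" "K \<subseteq> U" and w: "lower_barrier U w" "continuous_on UNIV w"
    and z: "z \<in> U" "u z + err < w z"
  obtains g where "path g" "path_image g \<subseteq> {x \<in> U. u x < w x}" "pathstart g = z" "pathfinish g \<notin> K"
proof -
  define S where "S = {x \<in> U. u x < w x}"
  have "open (U \<inter> (\<lambda>x. w x - u x) -` {0<..})"
    using u_cont_B[OF U(2)] U(1) continuous_on_subset[OF w(2)]
    by (intro continuous_open_preimage continuous_intros) auto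
  moreover have "U \<inter> (\<lambda>x. w x - u x) -` {0<..} = S" by (auto simp: S_def)
  ultimately have S: "open S" by simp
  have zS: "z \<in> S" using z err_nonneg by (simp add: S_def)
  let ?C = "connected_component_set S z"
  have "\<not> ?C \<subseteq> K"
  proof
    assume C: "?C \<subseteq> K"
    then have cl: "closure ?C \<subseteq> K" using K(1) by (rule closure_minimal)
    have "w z \<le> u z + err"
    proof (rule lower_barrierD[OF w(1) open_connected_component[OF S]])
      show "closure ?C \<subseteq> B" using cl K U by blast
      show "?C \<subseteq> U" using C K by blast
      show "z \<in> ?C" using zS by simp
      fix x assume x: "x \<in> frontier ?C"
      then have "x \<in> U" using cl K by (auto simp: frontier_def)
      then show "w x \<le> u x" using frontier_component_disjoint[OF S x] by (auto simp: S_def)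
    qed
    then show False using z by simp
  qed
  then obtain q where "q \<in> ?C" "q \<notin> K" by blast
  then obtain g where "path g" "path_image g \<subseteq> S" "pathstart g = z" "pathfinish g = q"
    using path_in_component[OF S] by blast
  then show thesis using \<open>q \<notin> K\<close> unfolding S_def by (intro that) auto
qed

text \<open>If \<open>u\<close> were small at \<open>t\<close>, the barriers growing in the directions \<open>P\<close> and \<open>-P\<close> would produce
  a path of small values of \<open>u\<close> that has to cross \<open>\<gamma>\<close>.\<close>

lemma crossing_lower_bound:
  fixes P Q :: "real^2 \<Rightarrow> real"
  assumes P: "continuous_on UNIV P" and Q: "continuous_on UNIV Q"
    and inj: "\<And>x x'. P x = P x' \<Longrightarrow> Q x = Q x' \<Longrightarrow> x = x'"
    and \<alpha>: "0 < \<alpha>" and a: "2 \<le> a" and \<omega>: "0 < \<omega>" and K: "K * (\<omega> / 2)\<^sup>2 = 2 * a + 1"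
    and U: "{x. \<bar>P x\<bar> < a + 1 \<and> \<bar>Q x - h\<bar> < \<omega>} \<subseteq> B"
    and w: "\<And>\<sigma> \<mu> \<kappa>. \<bar>\<sigma>\<bar> = 1 \<Longrightarrow> 0 \<le> \<mu> \<Longrightarrow> lower_barrier {x. \<bar>P x\<bar> < a + 1 \<and> \<bar>Q x - h\<bar> < \<omega>}
      (\<lambda>x. \<mu> * (exp (\<alpha> * (\<sigma> * P x - K * (Q x - h)\<^sup>2)) - \<kappa>))"
    and m: "0 \<le> m"
    and \<gamma>: "path \<gamma>" "\<And>x. x \<in> path_image \<gamma> \<Longrightarrow> \<bar>P x\<bar> < a \<and> m < u x"
    and fQ: "Q (pathstart \<gamma>) \<le> h - \<omega>" "h + \<omega> \<le> Q (pathfinish \<gamma>)"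
    and t: "Q t = h" "\<bar>P t\<bar> \<le> a - 2"
  shows "(exp (- \<alpha> * (2 * a - 1)) - exp (- \<alpha> * (2 * a + 1))) * m \<le> u t + err"
proof (rule ccontr)
  assume neg: "\<not> ?thesis"
  define U where "U = {x. \<bar>P x\<bar> < a + 1 \<and> \<bar>Q x - h\<bar> < \<omega>}"
  \<comment> \<open>The barrier is negative beyond \<open>\<omega> / 2\<close>, so leaving
    \<open>L\<close> can only mean \<open>\<bar>P x\<bar> > a\<close>.\<close>
  define L where "L = {x. \<bar>P x\<bar> \<le> a \<and> \<bar>Q x - h\<bar> \<le> \<omega> / 2}"
  \<comment> \<open>Normalised so that the barrier stays at most \<open>m\<close> on
    \<open>U\<close>, where \<open>\<sigma> * P x < a + 1\<close>.\<close>
  define \<mu> where "\<mu> = m * exp (- \<alpha> * (a + 1))"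
  define w where "w = (\<lambda>\<sigma> x. \<mu> * (exp (\<alpha> * (\<sigma> * P x - K * (Q x - h)\<^sup>2)) - exp (- \<alpha> * a)))"
  have \<mu>: "0 \<le> \<mu>" using m by (simp add: \<mu>_def)
  have "0 < K * (\<omega> / 2)\<^sup>2" using K a by simp
  then have K0: "0 \<le> K" by (auto simp: zero_less_mult_iff)
  have "open U" "closed L" unfolding U_def L_def Collect_conj_eq
    by (intro open_Int closed_Int open_Collect_less closed_Collect_le continuous_intros P Q)+
  have UB: "U \<subseteq> B" using U by (simp add: U_def)
  have LU: "L \<subseteq> U" using \<omega> by (auto simp: U_def L_def)
  have tU: "t \<in> U" using t \<omega> by (simp add: U_def)
  have ex: "\<exists>g. path g \<and> pathstart g = t \<and> \<sigma> * P (pathfinish g) > a \<and>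
      (\<forall>x\<in>path_image g. \<bar>Q x - h\<bar> < \<omega> \<and> u x \<le> m)" if \<sigma>: "\<bar>\<sigma>\<bar> = 1" for \<sigma>
  proof -
    have \<sigma>_cases: "\<sigma> = 1 \<or> \<sigma> = - 1" using \<sigma> by linarith
    have wt: "(exp (- \<alpha> * (2 * a - 1)) - exp (- \<alpha> * (2 * a + 1))) * m \<le> w \<sigma> t"
    proof -
      have "- (a - 2) \<le> \<sigma> * P t" using t(2) \<sigma>_cases by auto
      then have "exp (- \<alpha> * (a - 2)) \<le> exp (\<alpha> * (\<sigma> * P t))"
        using \<alpha> by (auto simp: algebra_simps dest: mult_left_mono[of _ _ \<alpha>])
      then have "\<mu> * (exp (- \<alpha> * (a - 2)) - exp (- \<alpha> * a)) \<le> w \<sigma> t"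
        unfolding w_def t(1) using \<mu> by (intro mult_left_mono) auto
      moreover have "\<mu> * (exp (- \<alpha> * (a - 2)) - exp (- \<alpha> * a))
          = (exp (- \<alpha> * (2 * a - 1)) - exp (- \<alpha> * (2 * a + 1))) * m"
        unfolding \<mu>_def by (simp add: algebra_simps flip: exp_add)
      ultimately show ?thesis by simp
    qed
    have "continuous_on UNIV (w \<sigma>)" unfolding w_def by (intro continuous_intros P Q)
    moreover have "lower_barrier U (w \<sigma>)" unfolding U_def w_def using \<sigma> \<mu> by (rule assms)
    moreover have "u t + err < w \<sigma> t" using wt neg by linarith
    ultimately obtain g where g: "path g" "path_image g \<subseteq> {x \<in> U. u x < w \<sigma> x}"
      "pathstart g = t" "pathfinish g \<notin> L"
      using sublevel_escape[OF \<open>open U\<close> UB \<open>closed L\<close> LU _ _ tU] by blast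
    have in_g: "- a < \<sigma> * P x \<and> \<bar>Q x - h\<bar> < \<omega> / 2 \<and> u x \<le> m" if "x \<in> path_image g" for x
    proof -
      have x: "x \<in> U" "u x < w \<sigma> x" using that g(2) by auto
      \<comment> \<open>Nonnegativity of \<open>u\<close> makes the barrier positive along the path,
        and this confines the path.\<close>
      have "0 \<le> u x" using x(1) U u_nonneg_B by (auto simp: U_def)
      then have "0 < w \<sigma> x" using x by simp
      then have "exp (- \<alpha> * a) < exp (\<alpha> * (\<sigma> * P x - K * (Q x - h)\<^sup>2))"
        using \<mu> by (auto simp: w_def zero_less_mult_iff)
      then have "\<alpha> * (- a) < \<alpha> * (\<sigma> * P x - K * (Q x - h)\<^sup>2)" by simp
      then have *: "- a < \<sigma> * P x - K * (Q x - h)\<^sup>2" using \<alpha> by (simp only: mult_less_cancel_left_pos)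
      have P1: "\<sigma> * P x < a + 1" using x(1) \<sigma>_cases by (auto simp: U_def)
      \<comment> \<open>The value \<open>2 * a + 1\<close> is the whole range of
        \<open>\<sigma> * P\<close> from \<open>- a\<close> to \<open>a + 1\<close>: a larger
        penalty would make the barrier negative.\<close>
      have "K * (Q x - h)\<^sup>2 < K * (\<omega> / 2)\<^sup>2" using * P1 unfolding K by linarith
      then have "(Q x - h)\<^sup>2 < (\<omega> / 2)\<^sup>2" using K0 by (simp add: mult_less_cancel_left)
      then have "\<bar>Q x - h\<bar> < \<omega> / 2" using \<omega> by (metis abs_le_square_iff abs_of_pos half_gt_zero not_less)
      moreover have "0 \<le> K * (Q x - h)\<^sup>2" using K0 by simp
      moreover have "u x \<le> m"
      proof -
        have "\<alpha> * (\<sigma> * P x - K * (Q x - h)\<^sup>2) \<le> \<alpha> * (a + 1)"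
          using P1 \<open>0 \<le> K * (Q x - h)\<^sup>2\<close> \<alpha> by (intro mult_left_mono) auto
        then have "exp (\<alpha> * (\<sigma> * P x - K * (Q x - h)\<^sup>2)) - exp (- \<alpha> * a) \<le> exp (\<alpha> * (a + 1))"
          using exp_gt_zero[of "- \<alpha> * a"] by (smt (verit) exp_le_cancel_iff)
        then have "w \<sigma> x \<le> \<mu> * exp (\<alpha> * (a + 1))" unfolding w_def using \<mu> by (rule mult_left_mono)
        also have "\<dots> = m" by (simp add: \<mu>_def flip: exp_add)
        finally show ?thesis using x by simp
      qed
      ultimately show ?thesis using * by auto
    qed
    have "\<sigma> * P (pathfinish g) > a"
    proof -
      have "\<not> \<bar>P (pathfinish g)\<bar> \<le> a"
        using g(4) in_g[OF pathfinish_in_path_image] by (auto simp: L_def)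
      then show ?thesis using in_g[OF pathfinish_in_path_image] \<sigma>_cases by auto
    qed
    then show ?thesis using g in_g \<omega> by (intro exI[of _ g]) fastforce
  qed
  obtain g1 where g1: "path g1" "pathstart g1 = t" "P (pathfinish g1) > a"
    "\<And>x. x \<in> path_image g1 \<Longrightarrow> \<bar>Q x - h\<bar> < \<omega> \<and> u x \<le> m" using ex[of 1] by auto
  obtain g2 where g2: "path g2" "pathstart g2 = t" "P (pathfinish g2) < - a"
    "\<And>x. x \<in> path_image g2 \<Longrightarrow> \<bar>Q x - h\<bar> < \<omega> \<and> u x \<le> m" using ex[of "- 1"] by auto
  \<comment> \<open>Joined at \<open>t\<close>, the two escape paths run from \<open>P < - a\<close>
    to \<open>P > a\<close> inside the strip in \<open>Q\<close> that \<open>\<gamma>\<close>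
    traverses.\<close>
  define g where "g = reversepath g2 +++ g1"
  have g: "path g" "P (pathstart g) < - a" "P (pathfinish g) > a"
    "\<And>x. x \<in> path_image g \<Longrightarrow> \<bar>Q x - h\<bar> < \<omega> \<and> u x \<le> m"
    using g1 g2 by (auto simp: g_def path_image_join)
  obtain x x' where "x \<in> path_image \<gamma>" "x' \<in> path_image g" "P x = P x'" "Q x = Q x'"
  proof (rule crossing_paths_meet[OF \<gamma>(1) g(1) P Q, of "- a" a "h - \<omega>" "h + \<omega>"])
    show "\<And>x. x \<in> path_image \<gamma> \<Longrightarrow> - a < P x \<and> P x < a" using \<gamma>(2) by (force simp: abs_less_iff)
    show "\<And>x. x \<in> path_image g \<Longrightarrow> h - \<omega> < Q x \<and> Q x < h + \<omega>" using g(4) by (force simp: abs_less_iff)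
  qed (use fQ g that in auto)
  then show False using inj \<gamma>(2) g(4) by (metis not_less)
qed

text \<open>The barrier is at most \<open>m\<close> on the face \<open>\<sigma> * P x = b\<close>
  and nonpositive on the other sides, so it lies below \<open>u\<close> on the whole boundary. The
  lateral sides are handled by \<open>a + b \<le> K * \<omega>^2\<close>; \<open>c\<close> bounds
  the drop of the exponent between the face and \<open>t\<close>.\<close>

lemma propagation_lower_bound:
  fixes P Q :: "real^2 \<Rightarrow> real"
  assumes P: "continuous_on UNIV P" and Q: "continuous_on UNIV Q"
    and \<alpha>: "0 < \<alpha>" and \<sigma>: "\<bar>\<sigma>\<bar> = 1" and \<omega>: "0 < \<omega>" and K: "a + b \<le> K * \<omega>\<^sup>2" "0 \<le> K"
    and U: "{x. - a \<le> \<sigma> * P x \<and> \<sigma> * P x \<le> b \<and> \<bar>Q x - h\<bar> \<le> \<omega>} \<subseteq> B"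
    and w: "\<And>\<mu> \<kappa>. 0 \<le> \<mu> \<Longrightarrow> lower_barrier {x. \<bar>Q x - h\<bar> < \<omega>}
      (\<lambda>x. \<mu> * (exp (\<alpha> * (\<sigma> * P x - K * (Q x - h)\<^sup>2)) - \<kappa>))"
    and m: "\<And>x. \<sigma> * P x = b \<Longrightarrow> \<bar>Q x - h\<bar> \<le> \<omega> \<Longrightarrow> m \<le> u x"
    and t: "- a < \<sigma> * P t" "\<sigma> * P t < b" "\<bar>Q t - h\<bar> < \<omega>"
    and c: "- c \<le> \<sigma> * P t - K * (Q t - h)\<^sup>2 - b" "c \<le> a + b"
  shows "(exp (- \<alpha> * c) - exp (- \<alpha> * (a + b))) * m \<le> u t + err"
proof (cases "0 \<le> m")
  case False
  have "t \<in> B" using U t by auto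
  moreover have "exp (- \<alpha> * (a + b)) \<le> exp (- \<alpha> * c)" using c(2) \<alpha> by simp
  then have "(exp (- \<alpha> * c) - exp (- \<alpha> * (a + b))) * m \<le> 0"
    using False by (intro mult_nonneg_nonpos) auto
  ultimately show ?thesis using u_nonneg_B[of t] err_nonneg by linarith
next
  case True
  define D where "D = {x. - a < \<sigma> * P x \<and> \<sigma> * P x < b \<and> \<bar>Q x - h\<bar> < \<omega>}"
  define L where "L = {x. - a \<le> \<sigma> * P x \<and> \<sigma> * P x \<le> b \<and> \<bar>Q x - h\<bar> \<le> \<omega>}"
  define \<mu> where "\<mu> = m * exp (- \<alpha> * b)"
  define w where "w = (\<lambda>x. \<mu> * (exp (\<alpha> * (\<sigma> * P x - K * (Q x - h)\<^sup>2)) - exp (- \<alpha> * a)))"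
  have \<mu>: "0 \<le> \<mu>" using True by (simp add: \<mu>_def)
  have "open D" "closed L" unfolding D_def L_def Collect_conj_eq
    by (intro open_Int closed_Int open_Collect_less closed_Collect_le continuous_intros P Q)+
  have cl: "closure D \<subseteq> L" using \<open>closed L\<close> by (intro closure_minimal) (auto simp: D_def L_def)
  have "w t \<le> u t + err"
  proof (rule lower_barrierD[OF _ \<open>open D\<close>])
    show "lower_barrier {x. \<bar>Q x - h\<bar> < \<omega>} w" unfolding w_def using \<mu> by (rule assms)
    show "D \<subseteq> {x. \<bar>Q x - h\<bar> < \<omega>}" "t \<in> D" using t by (auto simp: D_def)
    show "closure D \<subseteq> B" using cl U by (auto simp: L_def)
    fix x assume "x \<in> frontier D"
    then have x: "x \<in> L" "x \<notin> D" using cl \<open>open D\<close> by (auto simp: frontier_def interior_open)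
    have u0: "0 \<le> u x" using x U u_nonneg_B by (auto simp: L_def)
    have sq: "0 \<le> K * (Q x - h)\<^sup>2" using K(2) by simp
    have low: "w x \<le> u x" if "\<sigma> * P x - K * (Q x - h)\<^sup>2 \<le> - a"
    proof -
      have "\<alpha> * (\<sigma> * P x - K * (Q x - h)\<^sup>2) \<le> - \<alpha> * a"
        using mult_left_mono[OF that, of \<alpha>] \<alpha> by simp
      then have "w x \<le> 0" unfolding w_def using \<mu> by (intro mult_nonneg_nonpos) auto
      then show ?thesis using u0 by simp
    qed
    consider "\<sigma> * P x = - a" | "\<sigma> * P x = b" | "\<bar>Q x - h\<bar> = \<omega>"
      using x by (force simp: D_def L_def)
    then show "w x \<le> u x"
    proof cases
      case 1
      then show ?thesis using low sq by linarith
    next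
      case 2
      have "\<alpha> * (\<sigma> * P x - K * (Q x - h)\<^sup>2) \<le> \<alpha> * b"
        using 2 sq \<alpha> by (intro mult_left_mono) auto
      then have "exp (\<alpha> * (\<sigma> * P x - K * (Q x - h)\<^sup>2)) - exp (- \<alpha> * a) \<le> exp (\<alpha> * b)"
        using exp_gt_zero[of "- \<alpha> * a"] by (smt (verit) exp_le_cancel_iff)
      then have "w x \<le> \<mu> * exp (\<alpha> * b)" unfolding w_def using \<mu> by (rule mult_left_mono)
      also have "\<dots> = m" by (simp add: \<mu>_def flip: exp_add)
      also have "\<dots> \<le> u x" using m[of x] 2 x by (auto simp: L_def)
      finally show ?thesis .
    next
      case 3
      then have "(Q x - h)\<^sup>2 = \<omega>\<^sup>2" by (metis power2_abs)
      then show ?thesis using low K x by (auto simp: L_def)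
    qed
  qed
  moreover have "(exp (- \<alpha> * c) - exp (- \<alpha> * (a + b))) * m \<le> w t"
  proof -
    have "\<alpha> * (b - c) \<le> \<alpha> * (\<sigma> * P t - K * (Q t - h)\<^sup>2)"
      using c(1) \<alpha> by (intro mult_left_mono) auto
    then have "\<mu> * (exp (\<alpha> * (b - c)) - exp (- \<alpha> * a)) \<le> w t"
      unfolding w_def using \<mu> by (intro mult_left_mono) auto
    moreover have "\<mu> * (exp (\<alpha> * (b - c)) - exp (- \<alpha> * a)) = (exp (- \<alpha> * c) - exp (- \<alpha> * (a + b))) * m"
      unfolding \<mu>_def by (simp add: algebra_simps flip: exp_add)
    ultimately show ?thesis by simp
  qed
  ultimately show ?thesis by linarith
qed

end

section \<open>The Harnack inequality\<close>

lemma exp_gap: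
  assumes "0 < \<alpha>" "0 \<le> a" "a < (b::real)"
  shows "0 < exp (- \<alpha> * a) - exp (- \<alpha> * b)" "exp (- \<alpha> * a) - exp (- \<alpha> * b) \<le> 1"
proof -
  have "- \<alpha> * b < - \<alpha> * a" using assms by simp
  then show "0 < exp (- \<alpha> * a) - exp (- \<alpha> * b)" by simp
  have "exp (- \<alpha> * a) \<le> 1" using assms by simp
  then show "exp (- \<alpha> * a) - exp (- \<alpha> * b) \<le> 1" using exp_ge_zero[of "- \<alpha> * b"] by linarith
qed

text \<open>\<open>423200 = 2 * 23^2 * 400\<close>: on the ball
  \<open>\<bar>x $ 1\<bar> \<le> 23 * (r + \<bar>y $ 1\<bar>)\<close>, the number 400 caps the
  penalties \<open>K\<close> (those used are 15/4, 20, 76 and 176), and 2 comes from differentiating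
  a square twice.\<close>

definition barrier_rate :: "real \<Rightarrow> real \<Rightarrow> real" where
  "barrier_rate lam Lam = 423200 * Lam / lam"

section \<open>Normalised coordinates and calibrated barriers\<close>

context grushin_solution
begin

abbreviation "\<alpha> \<equiv> barrier_rate lam Lam"

definition \<xi> :: "real^2 \<Rightarrow> real" where "\<xi> x = (x $ 1 - y $ 1) / r"

definition \<zeta> :: "real^2 \<Rightarrow> real" where "\<zeta> x = (x $ 2 - y $ 2) / (r * (r + \<bar>y $ 1\<bar>))"

lemma rate_pos: "0 < \<alpha>"
  using lam by (simp add: barrier_rate_def)

lemma scale_pos: "0 < r + \<bar>y $ 1\<bar>" "0 < r * (r + \<bar>y $ 1\<bar>)"
  using r by (auto intro!: mult_pos_pos add_pos_nonneg)

lemma cont_\<xi>: "continuous_on S \<xi>" and cont_\<zeta>: "continuous_on S \<zeta>"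
proof -
  show "continuous_on S \<xi>"
    unfolding \<xi>_def[abs_def] using r by (intro continuous_intros) simp
  have "r * (r + \<bar>y $ 1\<bar>) \<noteq> 0" using scale_pos by linarith
  then show "continuous_on S \<zeta>"
    unfolding \<zeta>_def[abs_def] by (intro continuous_intros ballI)
qed

lemma coordinates_inj: "\<xi> x = \<xi> x' \<Longrightarrow> \<zeta> x = \<zeta> x' \<Longrightarrow> x = x'"
  using r scale_pos by (auto simp: \<xi>_def \<zeta>_def vec_eq_iff forall_2)

lemma fst_eq_\<xi>: "x $ 1 = y $ 1 + r * \<xi> x"
  using r by (simp add: \<xi>_def)

lemma box_subset: "\<bar>\<xi> x\<bar> \<le> 10 \<Longrightarrow> \<bar>\<zeta> x\<bar> \<le> 6 \<Longrightarrow> x \<in> B"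
  using r scale_pos
  by (intro box_subset_grushin_ball) (simp_all add: \<xi>_def \<zeta>_def abs_divide abs_mult field_simps)

lemma ball_in_box:
  assumes "x \<in> grushin_ball y r"
  shows "\<bar>\<xi> x\<bar> \<le> 1" "\<bar>\<zeta> x\<bar> \<le> 1"
  using grushin_ball_subset_box[OF assms] r scale_pos
  by (auto simp: \<xi>_def \<zeta>_def abs_divide abs_mult field_simps)

text \<open>The growth is along \<open>x_1\<close>, where ellipticity survives on the axis, so
  \<open>T\<close> is arbitrary. The penalty enters with weight \<open>x_1^2\<close>; divided by the
  squared vertical scale this is at most a constant over \<open>r^2\<close>, like the squared growth
  rate.\<close>

lemma lower_barrier_\<xi>:
  assumes \<sigma>: "\<bar>\<sigma>\<bar> = 1" and K: "0 \<le> K" "K \<le> 400" and \<mu>: "0 \<le> \<mu>"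
  shows "lower_barrier T (\<lambda>x. \<mu> * (exp (\<alpha> * (\<sigma> * \<xi> x - K * (\<zeta> x - h)\<^sup>2)) - \<kappa>))"
  unfolding lower_barrier_def
proof (intro allI impI ballI)
  define l where "l = r + \<bar>y $ 1\<bar>"
  define s where "s = r * l"
  have s: "0 < s" "0 < l" using scale_pos by (auto simp: s_def l_def)
  let ?q = "\<alpha> * K / s\<^sup>2" and ?p = "\<alpha> * \<sigma> / r"
  have eq: "barrier_exp ?p 0 (y $ 1) 0 ?q (y $ 2 + h * s) x = exp (\<alpha> * (\<sigma> * \<xi> x - K * (\<zeta> x - h)\<^sup>2))" for x
  proof -
    have "\<zeta> x - h = (x $ 2 - (y $ 2 + h * s)) / s"
      using s by (simp add: \<zeta>_def s_def l_def field_simps)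
    then have "(\<zeta> x - h)\<^sup>2 = (x $ 2 - (y $ 2 + h * s))\<^sup>2 / s\<^sup>2" by (simp add: power_divide)
    then show ?thesis by (simp add: barrier_exp_def \<xi>_def algebra_simps)
  qed
  fix D z
  assume D: "open D" "closure D \<subseteq> B" and bd: "\<forall>x\<in>frontier D.
      \<mu> * (exp (\<alpha> * (\<sigma> * \<xi> x - K * (\<zeta> x - h)\<^sup>2)) - \<kappa>) \<le> u x" and z: "z \<in> D"
  have "\<mu> * (barrier_exp ?p 0 (y $ 1) 0 ?q (y $ 2 + h * s) z - \<kappa>) \<le> u z + err"
  proof (rule barrier_le_u[OF D \<mu> _ _ _ _ z])
    show "0 \<le> ?q" using rate_pos K by simp
    fix x assume "x \<in> D"
    then have "x \<in> B" using D closure_subset by blast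
    then have "\<bar>x $ 1\<bar> \<le> 23 * l" using grushin_ball_subset_box(1)[of x y "23 * r"] r by (auto simp: l_def)
    then have x: "(x $ 1)\<^sup>2 \<le> (23 * l)\<^sup>2" by (metis abs_le_square_iff abs_of_nonneg abs_ge_zero order_trans)
    have "2 * Lam * ((x $ 1)\<^sup>2 * ?q) \<le> 2 * Lam * ((23 * l)\<^sup>2 * (\<alpha> * 400 / s\<^sup>2))"
      using lam K rate_pos by (intro mult_left_mono mult_mono x divide_right_mono) auto
    also have "\<dots> = lam * ?p\<^sup>2"
    proof -
      have "\<sigma>\<^sup>2 = 1" using \<sigma> by (metis one_power2 power2_abs)
      then show ?thesis
        using s r lam by (simp add: s_def power_mult_distrib power_divide barrier_rate_def field_simps power2_eq_square)
    qed
    finally show "2 * Lam * (0 + (x $ 1)\<^sup>2 * ?q) \<le> lam * ((?p - 2 * 0 * (x $ 1 - y $ 1))\<^sup>2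
        + (x $ 1)\<^sup>2 * (0 - 2 * ?q * (x $ 2 - (y $ 2 + h * s)))\<^sup>2)"
      using lam by (simp add: distrib_left add_increasing2)
  qed (use bd in \<open>simp_all add: eq\<close>)
  then show "\<mu> * (exp (\<alpha> * (\<sigma> * \<xi> z - K * (\<zeta> z - h)\<^sup>2)) - \<kappa>) \<le> u z + err"
    by (simp add: eq)
qed

text \<open>Unlike \<open>lower_barrier_\<xi>\<close>, this needs \<open>T\<close> to stay away from the axis where the operator degenerates.\<close>

lemma lower_barrier_\<zeta>:
  assumes \<sigma>: "\<bar>\<sigma>\<bar> = 1" and K: "0 \<le> K" "K \<le> 400" and \<mu>: "0 \<le> \<mu>"
    and T: "\<And>x. x \<in> T \<Longrightarrow> (r + \<bar>y $ 1\<bar>) / 10 \<le> \<bar>x $ 1\<bar>"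
  shows "lower_barrier T (\<lambda>x. \<mu> * (exp (\<alpha> * (\<sigma> * \<zeta> x - K * (\<xi> x - h)\<^sup>2)) - \<kappa>))"
  unfolding lower_barrier_def
proof (intro allI impI ballI)
  define l where "l = r + \<bar>y $ 1\<bar>"
  define s where "s = r * l"
  have s: "0 < s" "0 < l" using scale_pos by (auto simp: s_def l_def)
  let ?q = "\<alpha> * K / r\<^sup>2" and ?p = "\<alpha> * \<sigma> / s"
  have eq: "barrier_exp 0 ?q (y $ 1 + h * r) ?p 0 (y $ 2) x = exp (\<alpha> * (\<sigma> * \<zeta> x - K * (\<xi> x - h)\<^sup>2))" for x
  proof -
    have "\<xi> x - h = (x $ 1 - (y $ 1 + h * r)) / r"
      using r by (simp add: \<xi>_def field_simps)
    then have "(\<xi> x - h)\<^sup>2 = (x $ 1 - (y $ 1 + h * r))\<^sup>2 / r\<^sup>2" by (simp add: power_divide)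
    then show ?thesis by (simp add: barrier_exp_def \<zeta>_def s_def l_def algebra_simps)
  qed
  fix D z
  assume D: "open D" "closure D \<subseteq> B" and DT: "D \<subseteq> T" and bd: "\<forall>x\<in>frontier D.
      \<mu> * (exp (\<alpha> * (\<sigma> * \<zeta> x - K * (\<xi> x - h)\<^sup>2)) - \<kappa>) \<le> u x" and z: "z \<in> D"
  have "\<mu> * (barrier_exp 0 ?q (y $ 1 + h * r) ?p 0 (y $ 2) z - \<kappa>) \<le> u z + err"
  proof (rule barrier_le_u[OF D \<mu> _ _ _ _ z])
    show "0 \<le> ?q" using rate_pos K by simp
    fix x assume "x \<in> D"
    then have "l / 10 \<le> \<bar>x $ 1\<bar>" using DT T by (auto simp: l_def)
    then have x: "(l / 10)\<^sup>2 \<le> (x $ 1)\<^sup>2" using s by (metis abs_le_square_iff abs_of_pos divide_pos_pos zero_less_numeral)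
    have "2 * Lam * ?q \<le> 2 * Lam * (\<alpha> * 400 / r\<^sup>2)"
      using lam K rate_pos by (intro mult_left_mono divide_right_mono) auto
    \<comment> \<open>The growth along \<open>x_2\<close> counts with weight at least
      \<open>(l / 10)^2\<close>, which leaves one hundredth of 423200 against the required
      \<open>2 * 400\<close>.\<close>
    also have "\<dots> \<le> Lam * (4232 * \<alpha> / r\<^sup>2)"
      using lam rate_pos r by (simp add: field_simps)
    also have "\<dots> = lam * ((l / 10)\<^sup>2 * ?p\<^sup>2)"
    proof -
      have "\<sigma>\<^sup>2 = 1" using \<sigma> by (metis one_power2 power2_abs)
      then show ?thesis
        using s r lam by (simp add: s_def power_mult_distrib power_divide barrier_rate_def field_simps power2_eq_square)
    qed
    also have "\<dots> \<le> lam * ((x $ 1)\<^sup>2 * ?p\<^sup>2)"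
      using lam by (intro mult_left_mono mult_right_mono x) auto
    finally show "2 * Lam * (?q + (x $ 1)\<^sup>2 * 0) \<le> lam * ((0 - 2 * ?q * (x $ 1 - (y $ 1 + h * r)))\<^sup>2
        + (x $ 1)\<^sup>2 * (?p - 2 * 0 * (x $ 2 - y $ 2))\<^sup>2)"
      using lam by (simp add: distrib_left add_increasing)
  qed (use bd in \<open>simp_all add: eq\<close>)
  then show "\<mu> * (exp (\<alpha> * (\<sigma> * \<zeta> z - K * (\<xi> z - h)\<^sup>2)) - \<kappa>) \<le> u z + err"
    by (simp add: eq)
qed

text \<open>If \<open>y\<close> lies on side \<open>e\<close> of the axis, or at least
  \<open>4 * r\<close> away from it, the strip around \<open>3 / 2\<close> stays on the side of
  \<open>y\<close>. Otherwise the strip around \<open>11 / 2\<close> starts at distance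
  \<open>5 * r\<close> from \<open>y\<close> and lies beyond the axis. The bounds on
  \<open>n\<close> place the strip between the inner box and
  \<open>\<bar>\<xi> x\<bar> = 7\<close>.\<close>

lemma nondegenerate_strip:
  assumes e: "\<bar>e\<bar> = (1::real)"
  obtains n where "3 / 2 \<le> e * n" "e * n \<le> 13 / 2" "\<And>x. \<bar>\<xi> x - n\<bar> < 1 / 2 \<Longrightarrow> (r + \<bar>y $ 1\<bar>) / 10 \<le> \<bar>x $ 1\<bar>"
proof -
  have e1: "e = 1 \<or> e = - 1" using e by linarith
  then have ee: "e * e = 1" by auto
  define k :: real where "k = (if 0 \<le> e * y $ 1 \<or> 4 * r \<le> \<bar>y $ 1\<bar> then 3 / 2 else 11 / 2)"
  show thesis
  proof (rule that[of "e * k"])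
    show "3 / 2 \<le> e * (e * k)" "e * (e * k) \<le> 13 / 2"
      using ee by (auto simp: k_def simp flip: mult.assoc)
    fix x assume x: "\<bar>\<xi> x - e * k\<bar> < 1 / 2"
    have "e * \<xi> x - k = e * (\<xi> x - e * k)" using ee by (simp add: algebra_simps flip: mult.assoc)
    then have "\<bar>e * \<xi> x - k\<bar> < 1 / 2" using x e by (simp add: abs_mult)
    then have "k - 1 / 2 \<le> e * \<xi> x" "e * \<xi> x \<le> k + 1 / 2" by linarith+
    then have b: "r * (k - 1 / 2) \<le> r * (e * \<xi> x)" "r * (e * \<xi> x) \<le> r * (k + 1 / 2)"
      using r by (auto intro!: mult_left_mono)
    define v where "v = r * (e * \<xi> x)"
    define x1 where "x1 = e * x $ 1"
    define y1 where "y1 = e * y $ 1"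
    have ex: "x1 = y1 + v" unfolding fst_eq_\<xi>[of x] x1_def y1_def v_def by (simp add: algebra_simps)
    have abs1: "\<bar>x1\<bar> = \<bar>x $ 1\<bar>" "\<bar>y1\<bar> = \<bar>y $ 1\<bar>" using e by (simp_all add: abs_mult x1_def y1_def)
    consider "0 \<le> y1" | "y1 < 0" "4 * r \<le> \<bar>y $ 1\<bar>" | "y1 < 0" "\<bar>y $ 1\<bar> < 4 * r" by linarith
    then have "(r + \<bar>y1\<bar>) / 10 \<le> \<bar>x1\<bar>"
    proof cases
      case 1
      then have "r \<le> v" using b(1) by (simp add: k_def y1_def v_def)
      moreover have "\<bar>x1\<bar> = x1" "\<bar>y1\<bar> = y1" using calculation ex 1 r by auto
      ultimately show ?thesis using ex 1 r by simp
    next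
      case 2
      then have "v \<le> 2 * r" using b(2) by (simp add: k_def y1_def v_def)
      moreover have "\<bar>y1\<bar> = - y1" "4 * r \<le> - y1" using 2 abs1(2) by simp_all
      moreover from calculation have "\<bar>x1\<bar> = - x1" using ex r by simp
      ultimately show ?thesis using ex r by simp
    next
      case 3
      then have "5 * r \<le> v" using b(1) by (simp add: k_def y1_def v_def)
      moreover have "\<bar>y1\<bar> = - y1" "- y1 < 4 * r" using 3 abs1(2) by simp_all
      moreover from calculation have "\<bar>x1\<bar> = x1" using ex r by simp
      ultimately show ?thesis using ex r by simp
    qed
    then show "(r + \<bar>y $ 1\<bar>) / 10 \<le> \<bar>x $ 1\<bar>" unfolding abs1 .
  qed
qed

lemma inner_box_lower_bound:
  assumes n: "3 / 2 \<le> \<bar>n\<bar>" "\<bar>n\<bar> \<le> 13 / 2"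
    and m: "\<And>x. \<xi> x = n \<Longrightarrow> \<bar>\<zeta> x\<bar> \<le> 2 \<Longrightarrow> m \<le> u x"
    and t: "\<bar>\<xi> t\<bar> \<le> 1" "\<bar>\<zeta> t\<bar> \<le> 1"
  shows "(exp (- \<alpha> * 12) - exp (- \<alpha> * 15)) * m \<le> u t + err"
proof (cases "0 \<le> m")
  case False
  have "t \<in> B" using t by (intro box_subset) auto
  moreover have "(exp (- \<alpha> * 12) - exp (- \<alpha> * 15)) * m \<le> 0"
    using False exp_gap(1)[OF rate_pos, of 12 15] by (intro mult_nonneg_nonpos) auto
  ultimately show ?thesis using u_nonneg_B[of t] err_nonneg by linarith
next
  case True
  define \<sigma> where "\<sigma> = sgn n"
  have \<sigma>: "\<bar>\<sigma>\<bar> = 1" "\<sigma> * n = \<bar>n\<bar>" "\<sigma> = 1 \<or> \<sigma> = - 1" using n by (auto simp: \<sigma>_def sgn_if)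
  have \<sigma>n: "\<xi> x = n" if "\<sigma> * \<xi> x = \<bar>n\<bar>" for x using that \<sigma> by auto
  have t': "\<bar>\<sigma> * \<xi> t\<bar> \<le> 1" using t \<sigma> by (simp add: abs_mult)
  have "(\<zeta> t)\<^sup>2 \<le> 1\<^sup>2" using t(2) by (metis abs_le_square_iff abs_1)
  then have "15 / 4 * (\<zeta> t - 0)\<^sup>2 \<le> 15 / 4" by simp
  then have "(exp (- \<alpha> * (5 + \<bar>n\<bar>)) - exp (- \<alpha> * (8 + \<bar>n\<bar>))) * m \<le> u t + err"
  \<comment> \<open>\<open>15 / 4 * 2^2 = 15\<close> covers the range
    \<open>8 + \<bar>n\<bar>\<close>. At \<open>t\<close> the penalty is at most 15/4 and
    \<open>\<sigma> * \<xi> t \<ge> - 1\<close>, so the drop is at most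
    \<open>5 + \<bar>n\<bar>\<close>.\<close>
  proof (intro propagation_lower_bound[OF cont_\<xi> cont_\<zeta> rate_pos \<sigma>(1), of 2 8 "\<bar>n\<bar>" "15 / 4" 0])
    show "{x. - 8 \<le> \<sigma> * \<xi> x \<and> \<sigma> * \<xi> x \<le> \<bar>n\<bar> \<and> \<bar>\<zeta> x - 0\<bar> \<le> 2} \<subseteq> B"
    proof
      fix x assume "x \<in> {x. - 8 \<le> \<sigma> * \<xi> x \<and> \<sigma> * \<xi> x \<le> \<bar>n\<bar> \<and> \<bar>\<zeta> x - 0\<bar> \<le> 2}"
      then show "x \<in> B" using \<sigma>(3) n(2) by (intro box_subset) auto
    qed
    show "\<And>\<mu> \<kappa>. 0 \<le> \<mu> \<Longrightarrow> lower_barrier {x. \<bar>\<zeta> x - 0\<bar> < 2}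
        (\<lambda>x. \<mu> * (exp (\<alpha> * (\<sigma> * \<xi> x - 15 / 4 * (\<zeta> x - 0)\<^sup>2)) - \<kappa>))"
      using \<sigma>(1) by (intro lower_barrier_\<xi>) auto
    show "\<And>x. \<sigma> * \<xi> x = \<bar>n\<bar> \<Longrightarrow> \<bar>\<zeta> x - 0\<bar> \<le> 2 \<Longrightarrow> m \<le> u x" using m \<sigma>n by simp
  qed (use n t t' in auto)
  moreover have "(exp (- \<alpha> * 12) - exp (- \<alpha> * 15)) * m \<le> (exp (- \<alpha> * (5 + \<bar>n\<bar>)) - exp (- \<alpha> * (8 + \<bar>n\<bar>))) * m"
  proof (rule mult_right_mono[OF _ True])
    \<comment> \<open>Replacing \<open>\<bar>n\<bar>\<close> by 7 makes the factor independent of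
      the strip.\<close>
    have "exp (- \<alpha> * 7) * (exp (- \<alpha> * 5) - exp (- \<alpha> * 8)) \<le> exp (- \<alpha> * \<bar>n\<bar>) * (exp (- \<alpha> * 5) - exp (- \<alpha> * 8))"
      using n rate_pos exp_gap(1)[OF rate_pos, of 5 8] by (intro mult_right_mono) auto
    then show "exp (- \<alpha> * 12) - exp (- \<alpha> * 15) \<le> exp (- \<alpha> * (5 + \<bar>n\<bar>)) - exp (- \<alpha> * (8 + \<bar>n\<bar>))"
      by (simp add: algebra_simps flip: exp_add)
  qed
  ultimately show ?thesis by linarith
qed

text \<open>Since \<open>\<gamma>\<close> may follow the axis, it is crossed with
  \<open>\<xi>\<close>-barriers, which bounds \<open>u\<close> on the segment at level
  \<open>h\<close>. That bound is moved vertically only inside the strip around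
  \<open>n\<close>.\<close>

lemma vertical_crossing:
  assumes h: "\<bar>h\<bar> = 2" and m: "0 \<le> m"
    and \<gamma>: "path \<gamma>" "\<And>x. x \<in> path_image \<gamma> \<Longrightarrow> \<bar>\<xi> x\<bar> < 8 \<and> m < u x"
    and \<gamma>h: "\<zeta> (pathstart \<gamma>) \<le> h - 1" "h + 1 \<le> \<zeta> (pathfinish \<gamma>)"
    and n: "\<bar>n\<bar> \<le> 13 / 2" "\<And>x. \<bar>\<xi> x - n\<bar> < 1 / 2 \<Longrightarrow> (r + \<bar>y $ 1\<bar>) / 10 \<le> \<bar>x $ 1\<bar>"
    and t: "\<xi> t = n" "\<bar>\<zeta> t\<bar> \<le> 2"
  shows "(exp (- \<alpha> * 4) - exp (- \<alpha> * 5)) * ((exp (- \<alpha> * 17) - exp (- \<alpha> * 19)) * m - err) \<le> u t + err"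
    (is "?d2 * (?d1 * m - err) \<le> _")
proof -
  have seg: "?d1 * m - err \<le> u x" if x: "\<zeta> x = h" "\<bar>\<xi> x\<bar> \<le> 7" for x
  proof -
    have "(exp (- \<alpha> * (2 * 9 - 1)) - exp (- \<alpha> * (2 * 9 + 1))) * m \<le> u x + err"
    \<comment> \<open>\<open>76 * (1/2)^2 = 19 = 2 * 9 + 1\<close>. The choice \<open>a = 9\<close>
      admits \<open>\<bar>\<xi> x\<bar> \<le> 7\<close> and just fits the half-width 10 of the
      box.\<close>
    proof (rule crossing_lower_bound[OF cont_\<xi> cont_\<zeta> coordinates_inj rate_pos, of 9 1 76 h m \<gamma>])
      show "{x. \<bar>\<xi> x\<bar> < 9 + 1 \<and> \<bar>\<zeta> x - h\<bar> < 1} \<subseteq> B" using h by (auto intro!: box_subset)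
      show "\<And>\<sigma> \<mu> \<kappa>. \<bar>\<sigma>\<bar> = 1 \<Longrightarrow> 0 \<le> \<mu> \<Longrightarrow> lower_barrier {x. \<bar>\<xi> x\<bar> < 9 + 1 \<and> \<bar>\<zeta> x - h\<bar> < 1}
          (\<lambda>x. \<mu> * (exp (\<alpha> * (\<sigma> * \<xi> x - 76 * (\<zeta> x - h)\<^sup>2)) - \<kappa>))"
        by (intro lower_barrier_\<xi>) auto
      show "\<And>x. x \<in> path_image \<gamma> \<Longrightarrow> \<bar>\<xi> x\<bar> < 9 \<and> m < u x" using \<gamma>(2) by force
    qed (use m \<gamma> \<gamma>h x in \<open>auto simp: power2_eq_square\<close>)
    then show ?thesis by simp
  qed
  define \<sigma> where "\<sigma> = sgn h"
  have \<sigma>: "\<bar>\<sigma>\<bar> = 1" "\<sigma> = 1 \<or> \<sigma> = - 1" and \<sigma>h: "\<And>x. \<sigma> * \<zeta> x = 2 \<Longrightarrow> \<zeta> x = h"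
    using h by (auto simp: \<sigma>_def sgn_if abs_if split: if_splits)
  show ?thesis
  proof (cases "\<sigma> * \<zeta> t < 2")
    case True
    have "(exp (- \<alpha> * 4) - exp (- \<alpha> * (3 + 2))) * (?d1 * m - err) \<le> u t + err"
    \<comment> \<open>\<open>20 * (1/2)^2 = 5 = 3 + 2\<close>. The far side sits at
      \<open>- 3\<close>, one unit beyond the lowest admissible \<open>t\<close>.\<close>
    proof (rule propagation_lower_bound[OF cont_\<zeta> cont_\<xi> rate_pos \<sigma>(1), of "1 / 2" 3 2 20 n])
      show "{x. - 3 \<le> \<sigma> * \<zeta> x \<and> \<sigma> * \<zeta> x \<le> 2 \<and> \<bar>\<xi> x - n\<bar> \<le> 1 / 2} \<subseteq> B"
      proof
        fix x assume "x \<in> {x. - 3 \<le> \<sigma> * \<zeta> x \<and> \<sigma> * \<zeta> x \<le> 2 \<and> \<bar>\<xi> x - n\<bar> \<le> 1 / 2}"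
        then have "- 3 \<le> \<sigma> * \<zeta> x" "\<sigma> * \<zeta> x \<le> 2" "\<bar>\<xi> x - n\<bar> \<le> 1 / 2" by auto
        then have "\<bar>\<xi> x\<bar> \<le> 10" "\<bar>\<zeta> x\<bar> \<le> 6" using \<sigma>(2) n(1) by (linarith, auto)
        then show "x \<in> B" by (rule box_subset)
      qed
      show "\<And>\<mu> \<kappa>. 0 \<le> \<mu> \<Longrightarrow> lower_barrier {x. \<bar>\<xi> x - n\<bar> < 1 / 2}
          (\<lambda>x. \<mu> * (exp (\<alpha> * (\<sigma> * \<zeta> x - 20 * (\<xi> x - n)\<^sup>2)) - \<kappa>))"
        using \<sigma>(1) n(2) by (intro lower_barrier_\<zeta>) auto
      show "?d1 * m - err \<le> u x" if "\<sigma> * \<zeta> x = 2" "\<bar>\<xi> x - n\<bar> \<le> 1 / 2" for x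
      proof -
        have "\<bar>\<xi> x\<bar> \<le> 7" using that(2) n(1) by linarith
        then show ?thesis using that(1) by (intro seg \<sigma>h)
      qed
      show "- 3 < \<sigma> * \<zeta> t" "- 4 \<le> \<sigma> * \<zeta> t - 20 * (\<xi> t - n)\<^sup>2 - 2" using t \<sigma>(2) by auto
    qed (use True t in \<open>auto simp: power2_eq_square\<close>)
    then show ?thesis by simp
  next
    case False
    then have "\<zeta> t = h" using t(2) \<sigma>(2) by (intro \<sigma>h) auto
    then have s: "?d1 * m - err \<le> u t" using t n(1) by (intro seg) auto
    have "t \<in> B" using t n by (intro box_subset) auto
    then have "0 \<le> u t" by (rule u_nonneg_B)
    have d2: "0 < ?d2" "?d2 \<le> 1" using exp_gap[OF rate_pos, of 4 5] by auto
    have "?d2 * (?d1 * m - err) \<le> ?d2 * u t" using s d2 by (intro mult_left_mono) auto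
    also have "\<dots> \<le> 1 * u t" using \<open>0 \<le> u t\<close> d2 by (intro mult_right_mono) auto
    finally show ?thesis using err_nonneg by simp
  qed
qed

text \<open>The strip avoids the axis, so \<open>\<zeta>\<close>-barriers through \<open>t\<close>
  are available at once and cut the path within the strip; no intermediate segment is
  required.\<close>

lemma horizontal_crossing:
  assumes m: "0 \<le> m"
    and \<gamma>: "path \<gamma>" "\<And>x. x \<in> path_image \<gamma> \<Longrightarrow> \<bar>\<zeta> x\<bar> < 4 \<and> m < u x"
    and \<gamma>n: "\<xi> (pathstart \<gamma>) \<le> n - 1 / 2" "n + 1 / 2 \<le> \<xi> (pathfinish \<gamma>)"
    and n: "\<bar>n\<bar> \<le> 13 / 2" "\<And>x. \<bar>\<xi> x - n\<bar> < 1 / 2 \<Longrightarrow> (r + \<bar>y $ 1\<bar>) / 10 \<le> \<bar>x $ 1\<bar>"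
    and t: "\<xi> t = n" "\<bar>\<zeta> t\<bar> \<le> 2"
  shows "(exp (- \<alpha> * 9) - exp (- \<alpha> * 11)) * m \<le> u t + err"
proof -
  have "(exp (- \<alpha> * (2 * 5 - 1)) - exp (- \<alpha> * (2 * 5 + 1))) * m \<le> u t + err"
  \<comment> \<open>\<open>176 * (1/4)^2 = 11 = 2 * 5 + 1\<close>, and \<open>a + 1 = 6\<close> is
    the vertical half-width of the box.\<close>
  proof (rule crossing_lower_bound[OF cont_\<zeta> cont_\<xi> coordinates_inj rate_pos, of 5 "1 / 2" 176 n m \<gamma>])
    show "{x. \<bar>\<zeta> x\<bar> < 5 + 1 \<and> \<bar>\<xi> x - n\<bar> < 1 / 2} \<subseteq> B"
    proof
      fix x assume "x \<in> {x. \<bar>\<zeta> x\<bar> < 5 + 1 \<and> \<bar>\<xi> x - n\<bar> < 1 / 2}"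
      then have "\<bar>\<zeta> x\<bar> < 5 + 1" "\<bar>\<xi> x - n\<bar> < 1 / 2" by auto
      then have "\<bar>\<xi> x\<bar> \<le> 10" "\<bar>\<zeta> x\<bar> \<le> 6" using n(1) by linarith+
      then show "x \<in> B" by (rule box_subset)
    qed
    show "\<And>\<sigma> \<mu> \<kappa>. \<bar>\<sigma>\<bar> = 1 \<Longrightarrow> 0 \<le> \<mu> \<Longrightarrow> lower_barrier {x. \<bar>\<zeta> x\<bar> < 5 + 1 \<and> \<bar>\<xi> x - n\<bar> < 1 / 2}
        (\<lambda>x. \<mu> * (exp (\<alpha> * (\<sigma> * \<zeta> x - 176 * (\<xi> x - n)\<^sup>2)) - \<kappa>))"
      using n(2) by (intro lower_barrier_\<zeta>) auto
    show "\<And>x. x \<in> path_image \<gamma> \<Longrightarrow> \<bar>\<zeta> x\<bar> < 5 \<and> m < u x" using \<gamma>(2) by force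
  qed (use m \<gamma> \<gamma>n t in \<open>auto simp: power2_eq_square\<close>)
  then show ?thesis by simp
qed

end

section \<open>Combination of the escape directions\<close>

definition harnack_factor :: "real \<Rightarrow> real" where
  "harnack_factor \<alpha> = (exp (- \<alpha> * 17) - exp (- \<alpha> * 19)) * (exp (- \<alpha> * 9) - exp (- \<alpha> * 11)) *
     (exp (- \<alpha> * 4) - exp (- \<alpha> * 5)) * (exp (- \<alpha> * 12) - exp (- \<alpha> * 15))"

lemma harnack_factor_bounds:
  assumes "0 < \<alpha>"
  shows "0 < harnack_factor \<alpha>" "harnack_factor \<alpha> \<le> 1"
  unfolding harnack_factor_def
  by (intro mult_pos_pos mult_le_one mult_nonneg_nonneg exp_gap less_imp_le[OF exp_gap(1)] assms; simp)+

lemma (in grushin_solution) weak_harnack: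
  assumes z: "\<bar>\<xi> z\<bar> \<le> 1" "\<bar>\<zeta> z\<bar> \<le> 1" and p: "\<bar>\<xi> p\<bar> \<le> 1" "\<bar>\<zeta> p\<bar> \<le> 1"
  shows "harnack_factor \<alpha> * u z \<le> 2 * (u p + 3 * err)"
proof -
  have zB: "z \<in> B" and pB: "p \<in> B" using z p by (auto intro!: box_subset)
  note hf = harnack_factor_bounds[OF rate_pos]
  show ?thesis
  proof (cases "u z \<le> 2 * err")
    case True
    have "harnack_factor \<alpha> * u z \<le> u z"
      using hf u_nonneg_B[OF zB] by (intro mult_left_le_one_le) auto
    also note True
    also have "2 * err \<le> 2 * (u p + 3 * err)" using u_nonneg_B[OF pB] err_nonneg by simp
    finally show ?thesis by simp
  next
    case False
    \<comment> \<open>Half of \<open>u z\<close> is a level with margin more than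
      \<open>err\<close>, exactly because \<open>u z > 2 * err\<close>; smaller values of
      \<open>u z\<close> are absorbed by the error.\<close>
    define m where "m = u z / 2"
    have m: "0 \<le> m" "m + err < u z" using False err_nonneg by (auto simp: m_def)
    define d1 where "d1 = exp (- \<alpha> * 17) - exp (- \<alpha> * 19)"
    define d1' where "d1' = exp (- \<alpha> * 9) - exp (- \<alpha> * 11)"
    define d2 where "d2 = exp (- \<alpha> * 4) - exp (- \<alpha> * 5)"
    define d3 where "d3 = exp (- \<alpha> * 12) - exp (- \<alpha> * 15)"
    have d: "0 < d1" "d1 \<le> 1" "0 < d1'" "d1' \<le> 1" "0 < d2" "d2 \<le> 1" "0 < d3" "d3 \<le> 1"
      unfolding d1_def d1'_def d2_def d3_def by (intro exp_gap rate_pos; simp)+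
    have factor: "harnack_factor \<alpha> = d1 * d1' * d2 * d3"
      by (simp add: harnack_factor_def d1_def d1'_def d2_def d3_def)
    have vert: ?thesis if h: "\<bar>h\<bar> = 2" and \<gamma>: "path \<gamma>" "\<And>x. x \<in> path_image \<gamma> \<Longrightarrow> \<bar>\<xi> x\<bar> < 8 \<and> m < u x"
      "\<zeta> (pathstart \<gamma>) \<le> h - 1" "h + 1 \<le> \<zeta> (pathfinish \<gamma>)" for h \<gamma>
    proof -
      obtain n where n: "3 / 2 \<le> 1 * n" "1 * n \<le> 13 / 2"
        "\<And>x. \<bar>\<xi> x - n\<bar> < 1 / 2 \<Longrightarrow> (r + \<bar>y $ 1\<bar>) / 10 \<le> \<bar>x $ 1\<bar>"
        using nondegenerate_strip[of 1] by auto
      have "d2 * (d1 * m - err) - err \<le> u t" if "\<xi> t = n" "\<bar>\<zeta> t\<bar> \<le> 2" for t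
        using vertical_crossing[OF h m(1) \<gamma> _ n(3) that] n(1,2) by (simp add: d1_def d2_def)
      then have "d3 * (d2 * (d1 * m - err) - err) \<le> u p + err"
        unfolding d3_def using n(1,2) p by (intro inner_box_lower_bound[of n]) auto
      \<comment> \<open>Three comparisons, three errors: the earlier ones are only multiplied by
        factors at most 1. The gap \<open>d1'\<close> of the sideways case is inserted afterwards,
        so that all cases share one constant.\<close>
      then have "d1 * d2 * d3 * m \<le> u p + err + (d3 * err + d3 * d2 * err)"
        by (simp add: algebra_simps)
      also have "d3 * err + d3 * d2 * err \<le> 1 * err + 1 * err"
        using d err_nonneg by (intro add_mono mult_right_mono mult_le_one) auto
      finally have "d1 * d2 * d3 * m \<le> u p + 3 * err" by simp
      moreover have "d1' * (d1 * d2 * d3 * m) \<le> 1 * (d1 * d2 * d3 * m)"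
        using d m(1) by (intro mult_right_mono) auto
      ultimately show ?thesis by (simp add: factor m_def ac_simps)
    qed
    have horiz: ?thesis if n: "3 / 2 \<le> \<bar>n\<bar>" "\<bar>n\<bar> \<le> 13 / 2"
        "\<And>x. \<bar>\<xi> x - n\<bar> < 1 / 2 \<Longrightarrow> (r + \<bar>y $ 1\<bar>) / 10 \<le> \<bar>x $ 1\<bar>"
      and \<gamma>: "path \<gamma>" "\<And>x. x \<in> path_image \<gamma> \<Longrightarrow> \<bar>\<zeta> x\<bar> < 4 \<and> m < u x"
      "\<xi> (pathstart \<gamma>) \<le> n - 1 / 2" "n + 1 / 2 \<le> \<xi> (pathfinish \<gamma>)" for n \<gamma>
    proof -
      have "d1' * m - err \<le> u t" if "\<xi> t = n" "\<bar>\<zeta> t\<bar> \<le> 2" for t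
        using horizontal_crossing[OF m(1) \<gamma> n(2,3) that] by (simp add: d1'_def)
      then have "d3 * (d1' * m - err) \<le> u p + err"
        unfolding d3_def using n(1,2) p by (intro inner_box_lower_bound[of n]) auto
      then have "d1' * d3 * m \<le> u p + err + d3 * err" by (simp add: algebra_simps)
      also have "d3 * err \<le> 1 * err" using d err_nonneg by (intro mult_right_mono) auto
      finally have "d1' * d3 * m \<le> u p + 3 * err" using err_nonneg by simp
      moreover have "d1 * d2 * (d1' * d3 * m) \<le> 1 * (d1' * d3 * m)"
        using d m(1) by (intro mult_right_mono mult_le_one) auto
      ultimately show ?thesis by (simp add: factor m_def ac_simps)
    qed
    define U where "U = {x. \<bar>\<xi> x\<bar> < 8 \<and> \<bar>\<zeta> x\<bar> < 4}"
    \<comment> \<open>A path from the inner box to a point beyond 3 vertically passes from level 1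
      to level 3 around \<open>\<bar>h\<bar> = 2\<close>; beyond 7 horizontally, it passes the whole
      strip around \<open>n\<close>. Paths going down or left are reversed to match the
      orientation.\<close>
    define L where "L = {x. \<bar>\<xi> x\<bar> \<le> 7 \<and> \<bar>\<zeta> x\<bar> \<le> 3}"
    have "open U" "closed L" unfolding U_def L_def Collect_conj_eq
      by (intro open_Int closed_Int open_Collect_less closed_Collect_le continuous_intros cont_\<xi> cont_\<zeta>)+
    moreover have "U \<subseteq> B" "L \<subseteq> U" "z \<in> U" using z by (auto simp: U_def L_def intro!: box_subset)
    ultimately obtain \<gamma> where \<gamma>: "path \<gamma>" "path_image \<gamma> \<subseteq> {x \<in> U. m < u x}" "pathstart \<gamma> = z" "pathfinish \<gamma> \<notin> L"
      using superlevel_escape[of U L z m] m(2) by blast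
    have im: "\<bar>\<xi> x\<bar> < 8 \<and> m < u x" "\<bar>\<zeta> x\<bar> < 4 \<and> m < u x" if "x \<in> path_image \<gamma>" for x
      using \<gamma>(2) that by (auto simp: U_def)
    let ?q = "pathfinish \<gamma>"
    consider "3 < \<zeta> ?q" | "\<zeta> ?q < - 3" | "7 < \<xi> ?q" | "\<xi> ?q < - 7"
      using \<gamma>(4) by (force simp: L_def)
    then show ?thesis
    proof cases
      case 1
      then show ?thesis using vert[of 2 \<gamma>] \<gamma> im z by simp
    next
      case 2
      then show ?thesis using vert[of "- 2" "reversepath \<gamma>"] \<gamma> im z by simp
    next
      case 3
      obtain n where "3 / 2 \<le> 1 * n" "1 * n \<le> 13 / 2"
        "\<And>x. \<bar>\<xi> x - n\<bar> < 1 / 2 \<Longrightarrow> (r + \<bar>y $ 1\<bar>) / 10 \<le> \<bar>x $ 1\<bar>"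
        using nondegenerate_strip[of 1] by auto
      then show ?thesis using horiz[of n \<gamma>] \<gamma> im z 3 by simp
    next
      case 4
      obtain n where "3 / 2 \<le> (- 1) * n" "(- 1) * n \<le> 13 / 2"
        "\<And>x. \<bar>\<xi> x - n\<bar> < 1 / 2 \<Longrightarrow> (r + \<bar>y $ 1\<bar>) / 10 \<le> \<bar>x $ 1\<bar>"
        using nondegenerate_strip[of "- 1"] by auto
      then show ?thesis using horiz[of n "reversepath \<gamma>"] \<gamma> im z 4 by simp
    qed
  qed
qed

theorem theorem3p16:
  fixes lam Lam :: real
  assumes "0 < lam" and "lam \<le> Lam"
  shows "\<exists>C>1. \<exists>\<eta>>1.
    \<forall>(\<Omega> :: (real^2) set) (a11 :: real^2 \<Rightarrow> real) (a12 :: real^2 \<Rightarrow> real) (a22 :: real^2 \<Rightarrow> real)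
      (f :: real^2 \<Rightarrow> real) (u :: real^2 \<Rightarrow> real).
      open \<Omega> \<longrightarrow> grushin_coeffs \<Omega> lam Lam a11 a12 a22 \<longrightarrow>
      f \<in> borel_measurable (lebesgue_on \<Omega>) \<longrightarrow> bounded (f ` \<Omega>) \<longrightarrow>
      Ck_on 2 \<Omega> u \<longrightarrow> continuous_on (closure \<Omega>) u \<longrightarrow> (\<forall>x\<in>\<Omega>. 0 \<le> u x) \<longrightarrow>
      (\<forall>x\<in>\<Omega>. grushin_op a11 a12 a22 u x = (x $ 1)\<^sup>2 * f x) \<longrightarrow>
      (\<forall>(y :: real^2) (r :: real). 0 < r \<longrightarrow> grushin_ball y (\<eta> * r) \<subseteq> \<Omega> \<longrightarrow>
        (SUP x\<in>grushin_ball y r. u x)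
          \<le> C * ((INF x\<in>grushin_ball y r. u x)
               + diameter (grushin_ball y (\<eta> * r))
                   * L2_norm_on (grushin_ball y (\<eta> * r)) (\<lambda>x. x $ 1 * f x)))"
proof -
  define c where "c = harnack_factor (barrier_rate lam Lam)"
  define k where "k = 1 / (2 * lam * sqrt pi)"
  \<comment> \<open>\<open>2 / c\<close> comes from \<open>weak_harnack\<close>,
    \<open>1 + 3 * k\<close> absorbs the three errors, and the added 1 ensures
    \<open>C > 1\<close>.\<close>
  define C where "C = 2 / c * (1 + 3 * k) + 1"
  have "0 < barrier_rate lam Lam" using assms by (simp add: barrier_rate_def)
  then have c: "0 < c" unfolding c_def by (rule harnack_factor_bounds)
  have k: "0 < k" using assms by (simp add: k_def)
  have C: "1 < C" using c k by (simp add: C_def add_pos_pos)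
  show ?thesis
  proof (rule exI[of _ C], rule conjI[OF C], rule exI[of _ 23], intro conjI allI impI)
    fix \<Omega> :: "(real^2) set" and a11 a12 a22 f u :: "real^2 \<Rightarrow> real" and y :: "real^2" and r :: real
    assume asm: "open \<Omega>" "grushin_coeffs \<Omega> lam Lam a11 a12 a22"
      "f \<in> borel_measurable (lebesgue_on \<Omega>)" "bounded (f ` \<Omega>)" "Ck_on 2 \<Omega> u"
      "\<forall>x\<in>\<Omega>. 0 \<le> u x" "\<forall>x\<in>\<Omega>. grushin_op a11 a12 a22 u x = (x $ 1)\<^sup>2 * f x"
      "0 < r" "grushin_ball y (23 * r) \<subseteq> \<Omega>"
    interpret grushin_solution lam Lam \<Omega> a11 a12 a22 f u y r
      using assms asm by unfold_locales auto
    let ?b = "grushin_ball y r"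
    define N where "N = diameter B * L2_norm_on B (\<lambda>x. x $ 1 * f x)"
    have err: "err = k * N" by (simp add: err_def k_def N_def)
    then have N: "0 \<le> N" using err_nonneg k by (simp add: zero_le_mult_iff)
    have y: "y \<in> ?b" using r by (simp add: grushin_ball_def grushin_dist_def)
    have compare: "u z \<le> C * (u p + N)" if "z \<in> ?b" "p \<in> ?b" for z p
    proof -
      have p0: "0 \<le> u p" using ball_in_box[OF that(2)] by (intro u_nonneg_B box_subset) auto
      have "c * u z \<le> 2 * (u p + 3 * err)"
        unfolding c_def using ball_in_box[OF that(1)] ball_in_box[OF that(2)] by (rule weak_harnack)
      then have "u z \<le> 2 / c * (u p + 3 * k * N)" using c by (simp add: err field_simps)
      also have "\<dots> \<le> 2 / c * ((1 + 3 * k) * (u p + N))"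
        using c k p0 N by (intro mult_left_mono) (auto simp: algebra_simps)
      also have "\<dots> \<le> 2 / c * ((1 + 3 * k) * (u p + N)) + (u p + N)" using p0 N by simp
      also have "\<dots> = C * (u p + N)"
        by (simp only: C_def distrib_right[of _ 1] mult.assoc mult_1)
      finally show ?thesis .
    qed
    \<comment> \<open>The pointwise comparison holds for arbitrary pairs, so the supremum and the
      infimum can be taken separately; it also bounds \<open>u\<close> on the ball.\<close>
    have "(SUP z\<in>?b. u z) / C - N \<le> (INF p\<in>?b. u p)"
    proof (rule cINF_greatest)
      show "?b \<noteq> {}" using y by blast
      fix p assume "p \<in> ?b"
      then have "(SUP z\<in>?b. u z) \<le> C * (u p + N)" using y by (intro cSUP_least compare) auto
      then show "(SUP z\<in>?b. u z) / C - N \<le> u p" using C by (simp add: field_simps)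
    qed
    then have "(SUP x\<in>?b. u x) \<le> C * ((INF x\<in>?b. u x) + N)"
      using C by (simp add: field_simps)
    then show "(SUP x\<in>?b. u x) \<le> C * ((INF x\<in>?b. u x)
        + diameter B * L2_norm_on B (\<lambda>x. x $ 1 * f x))"
      unfolding N_def .
  qed simp
qed

end
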